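(* Let $\lambda,\delta,\sigma>0$, $c>0$ and $q\ge0$. Consider the spectrally negative Lévy process $$R_t=ct-\sum_{i=1}^{V_t^{(2)}}\xi_i+\sigma W_t,$$ where $V^{(2)}$ is the twice iterated Poisson process with intensity $\lambda$, the $\xi_i$ are i.i.d. exponential random variables with density $\delta e^{-\delta x}1_{[0,+\infty)}(x)$, $W$ is a standard Brownian motion, and $V^{(2)}$, $(\xi_i)$, $W$ are independent. Define $$\digamma(z)=\frac{\lambda(1-e^{-\lambda})+q}{c}\pi(z)-\frac{\lambda e^{-\lambda}}{c}(\pi*G)(z),$$ where $$G(x)=\frac{e^{-\delta x}\sqrt{\delta\lambda}\,I_1(2\sqrt{\delta\lambda x})}{\sqrt{x}},$$ $I_1$ is the modified Bessel function of the first kind of order $1$, and $\pi(x)=1$ on $[0,+\infty)$ and zero otherwise. The ($q$-)scale function of $R_t$ is then $$W_R^{(q)}(x)=\Bigl(\pi*\sum_{n=0}^{\infty}\digamma^{*n}*F_{n+1}\Bigr)(x),$$ where $F_{n+1}(x)=\frac{(2c/\sigma^2)^{n+1}x^n}{n!}e^{-\frac{2c}{\sigma^2}x}$ is the probability density function of the $\mathrm{Erlang}(n+1,2c/\sigma^2)$ distribution.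
   Context: Let $N^1,N^2$ be independent Poisson processes with the same intensity $\lambda>0$; the twice iterated Poisson process is $V_t^{(2)}=N^2_{N_t^1}$ (the process $N^2$ evaluated at time $N^1_t$). An empty sum is $0$. For a spectrally negative Lévy process $X$ (started at $0$, no positive jumps) the Laplace exponent $\psi$ is defined by $E[e^{\theta X_t}]=e^{\psi(\theta)t}$, $\theta\ge0$, and for $q\ge0$, $\Phi(q)=\sup\{\theta\ge0:\psi(\theta)=q\}$. The $q$-scale function $W^{(q)}$ of $X$ is defined to be $0$ on $(-\infty,0)$, and on $[0,+\infty)$ it is the unique right-continuous function with $\int_0^\infty e^{-\beta x}W^{(q)}(x)\,dx=\frac{1}{\psi(\beta)-q}$ for all $\beta>\Phi(q)$. For $R$ the Laplace exponent is $\psi_R(\theta)=c\theta-\lambda+\lambda e^{-\lambda+\lambda\frac{\delta}{\delta+\theta}}+\frac12\sigma^2\theta^2$. All functions are extended by $0$ to negative arguments, $(f*g)(x)=\int_0^x f(x-y)g(y)\,dy$, $f^{*n}$ is the $n$-fold convolution power, and $f^{*0}$ is the Dirac delta at $0$ (so $f^{*0}*g=g$).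
   Formalization: The printed formula for the scale function is off by a factor c (its Laplace transform is c/(ψ_R(β)−q)), so it fails for every c≠1; the formal version proves W_R^{(q)} = (1/c)·π*Σ ϝ^{*n}*F_{n+1}, which agrees with the printed one when c=1. *)

theory Defs
  imports "HOL-Probability.Probability"
begin

section \<open>Processes\<close>

text \<open>Processes are families indexed by real time; only times \<open>t \<ge> 0\<close> are meaningful.\<close>

definition independent_increments :: "'a measure \<Rightarrow> (real \<Rightarrow> 'a \<Rightarrow> real) \<Rightarrow> bool" where
  "independent_increments M X \<longleftrightarrow>
     (\<forall>(n::nat) (t::nat \<Rightarrow> real). 0 \<le> t 0 \<and> mono t \<longrightarrow>
        prob_space.indep_vars M (\<lambda>_. borel) (\<lambda>i \<omega>. X (t (Suc i)) \<omega> - X (t i) \<omega>) {..<n})"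

text \<open>The natural-number subtraction below does not truncate (almost surely), because the paths
  are nondecreasing.\<close>

definition poisson_process :: "'a measure \<Rightarrow> real \<Rightarrow> (real \<Rightarrow> 'a \<Rightarrow> nat) \<Rightarrow> bool" where
  "poisson_process M l N \<longleftrightarrow>
     (\<forall>t\<ge>0. N t \<in> measurable M (count_space UNIV)) \<and>
     (AE \<omega> in M. N 0 \<omega> = 0) \<and>
     (AE \<omega> in M. mono_on {0..} (\<lambda>t. N t \<omega>) \<and>
        (\<forall>t\<ge>0. ((\<lambda>s. real (N s \<omega>)) \<longlongrightarrow> real (N t \<omega>)) (at_right t))) \<and>
     independent_increments M (\<lambda>t \<omega>. real (N t \<omega>)) \<and>
     (\<forall>s t. 0 \<le> s \<and> s < t \<longrightarrow>
        distr M (count_space UNIV) (\<lambda>\<omega>. N t \<omega> - N s \<omega>) = measure_pmf (poisson_pmf (l * (t - s))))"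

definition brownian_motion :: "'a measure \<Rightarrow> (real \<Rightarrow> 'a \<Rightarrow> real) \<Rightarrow> bool" where
  "brownian_motion M B \<longleftrightarrow>
     (\<forall>t\<ge>0. B t \<in> borel_measurable M) \<and>
     (AE \<omega> in M. B 0 \<omega> = 0) \<and>
     (AE \<omega> in M. continuous_on {0..} (\<lambda>t. B t \<omega>)) \<and>
     independent_increments M B \<and>
     (\<forall>s t. 0 \<le> s \<and> s < t \<longrightarrow>
        distributed M lborel (\<lambda>\<omega>. B t \<omega> - B s \<omega>) (normal_density 0 (sqrt (t - s))))"

text \<open>The sigma-algebra on \<open>space M\<close> generated by the \<open>S\<close>-valued variables \<open>X i\<close>, \<open>i \<in> I\<close>.\<close>

definition process_events ::
    "'a measure \<Rightarrow> 'b measure \<Rightarrow> 'i set \<Rightarrow> ('i \<Rightarrow> 'a \<Rightarrow> 'b) \<Rightarrow> 'a set set" where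
  "process_events M S I X =
     sigma_sets (space M) {X i -` A \<inter> space M | i A. i \<in> I \<and> A \<in> sets S}"

definition twice_iterated ::
    "(real \<Rightarrow> 'a \<Rightarrow> nat) \<Rightarrow> (real \<Rightarrow> 'a \<Rightarrow> nat) \<Rightarrow> real \<Rightarrow> 'a \<Rightarrow> nat" where
  "twice_iterated N1 N2 t \<omega> = N2 (real (N1 t \<omega>)) \<omega>"

definition risk_process ::
    "real \<Rightarrow> real \<Rightarrow> (real \<Rightarrow> 'a \<Rightarrow> nat) \<Rightarrow> (nat \<Rightarrow> 'a \<Rightarrow> real) \<Rightarrow> (real \<Rightarrow> 'a \<Rightarrow> real) \<Rightarrow>
     real \<Rightarrow> 'a \<Rightarrow> real" where
  "risk_process c \<sigma> V \<xi> B t \<omega> = c * t - (\<Sum>i=1..V t \<omega>. \<xi> i \<omega>) + \<sigma> * B t \<omega>"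


section \<open>Scale functions\<close>

text \<open>The argument \<open>X\<close> is meant to be a spectrally negative Levy process and \<open>\<theta> \<ge> 0\<close>.\<close>

definition laplace_exponent :: "'a measure \<Rightarrow> (real \<Rightarrow> 'a \<Rightarrow> real) \<Rightarrow> real \<Rightarrow> real" where
  "laplace_exponent M X \<theta> =
     (THE p. \<forall>t\<ge>0. integrable M (\<lambda>\<omega>. exp (\<theta> * X t \<omega>)) \<and>
                  (\<integral>\<omega>. exp (\<theta> * X t \<omega>) \<partial>M) = exp (p * t))"

definition right_inverse :: "(real \<Rightarrow> real) \<Rightarrow> real \<Rightarrow> real" where
  "right_inverse \<psi> q = Sup {\<theta>. 0 \<le> \<theta> \<and> \<psi> \<theta> = q}"

definition is_scale_function :: "(real \<Rightarrow> real) \<Rightarrow> real \<Rightarrow> (real \<Rightarrow> real) \<Rightarrow> bool" where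
  "is_scale_function \<psi> q W \<longleftrightarrow>
     (\<forall>x<0. W x = 0) \<and>
     (\<forall>x\<ge>0. (W \<longlongrightarrow> W x) (at_right x)) \<and>
     (\<forall>\<beta>>right_inverse \<psi> q.
        set_integrable lborel {0..} (\<lambda>x. exp (- \<beta> * x) * W x) \<and>
        (LINT x:{0..}|lborel. exp (- \<beta> * x) * W x) = 1 / (\<psi> \<beta> - q))"

definition scale_function :: "'a measure \<Rightarrow> (real \<Rightarrow> 'a \<Rightarrow> real) \<Rightarrow> real \<Rightarrow> real \<Rightarrow> real" where
  "scale_function M X q = (THE W. is_scale_function (laplace_exponent M X) q W)"


section \<open>Convolutions and the Bessel kernel\<close>

definition conv :: "(real \<Rightarrow> real) \<Rightarrow> (real \<Rightarrow> real) \<Rightarrow> real \<Rightarrow> real" where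
  "conv f g x = (LINT y:{0..x}|lborel. f (x - y) * g y)"

text \<open>\<open>conv_power_conv f n g\<close> is \<open>f\<^sup>*\<^sup>n * g\<close>. The power \<open>f\<^sup>*\<^sup>0\<close> is the Dirac delta, which is not a
  function, hence the separate case; \<open>(conv f ^^ m) f\<close> is the power with exponent \<open>m + 1\<close>.\<close>

definition conv_power_conv :: "(real \<Rightarrow> real) \<Rightarrow> nat \<Rightarrow> (real \<Rightarrow> real) \<Rightarrow> real \<Rightarrow> real" where
  "conv_power_conv f n g = (case n of 0 \<Rightarrow> g | Suc m \<Rightarrow> conv ((conv f ^^ m) f) g)"

text \<open>Modified Bessel function of the first kind, of integer order \<open>n\<close>.\<close>

definition bessel_I :: "nat \<Rightarrow> real \<Rightarrow> real" where
  "bessel_I n z = (\<Sum>k. (z / 2) ^ (2 * k + n) / (fact k * fact (k + n)))"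

text \<open>At \<open>x = 0\<close> this evaluates to \<open>0\<close> (division by zero) instead of the limit \<open>\<delta> * l\<close>; this is
  immaterial, since the function is only used inside integrals.\<close>

definition G_kernel :: "real \<Rightarrow> real \<Rightarrow> real \<Rightarrow> real" where
  "G_kernel \<delta> l x =
     (if x < 0 then 0
      else exp (- \<delta> * x) * sqrt (\<delta> * l) * bessel_I 1 (2 * sqrt (\<delta> * l * x)) / sqrt x)"

definition unit_step :: "real \<Rightarrow> real" where
  "unit_step = indicator {0..}"

definition digamma_kernel :: "real \<Rightarrow> real \<Rightarrow> real \<Rightarrow> real \<Rightarrow> real \<Rightarrow> real" where
  "digamma_kernel l \<delta> c q z =
     (l * (1 - exp (- l)) + q) / c * unit_step z
     - l * exp (- l) / c * conv unit_step (G_kernel \<delta> l) z"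

text \<open>The summand is \<open>F\<^bsub>n+1\<^esub>\<close> convolved with the \<open>n\<close>-th convolution power of the kernel;
  \<open>F\<^bsub>n+1\<^esub>\<close>, the Erlang\<open>(n + 1, 2c / \<sigma>\<^sup>2)\<close> density, is \<open>erlang_density n (2 * c / \<sigma>\<^sup>2)\<close> in the
  indexing of the library.

  With \<open>D\<close> and \<open>E\<close> the Laplace transforms of the kernel and of \<open>F\<^sub>1\<close>, one has
  \<open>\<psi> \<beta> - q = c * \<beta> * (1 / E \<beta> - D \<beta>)\<close>. So the convolution of \<open>unit_step\<close> with the sum of these terms
  has the transform \<open>c / (\<psi> \<beta> - q)\<close>: with the normalisation \<open>1 / (\<psi> \<beta> - q)\<close> of the scale
  function, the latter is \<open>1 / c\<close> times that convolution. The source omits the factor \<open>1 / c\<close>.\<close>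

definition scale_term :: "real \<Rightarrow> real \<Rightarrow> real \<Rightarrow> real \<Rightarrow> real \<Rightarrow> nat \<Rightarrow> real \<Rightarrow> real" where
  "scale_term l \<delta> c \<sigma> q n =
     conv_power_conv (digamma_kernel l \<delta> c q) n (erlang_density n (2 * c / \<sigma>\<^sup>2))"

end

theory Submission
  imports Defs
begin

text \<open>Writing \<open>D\<close> and \<open>E\<close> for the Laplace transforms of the kernel and of the exponential density
  \<open>F\<^sub>1\<close>, the \<open>n\<close>-th term of the series has the transform \<open>D\<^sup>n E\<^sup>n\<^sup>+\<^sup>1\<close>. Since \<open>G\<close> has total mass
  \<open>exp l - 1\<close>, the kernel is nonnegative, so the series may be transformed termwise with values in
  the extended reals, and its transform is finite exactly where \<open>D E < 1\<close>. As
  \<open>\<psi> \<beta> - q = c \<beta> (1 / E - D)\<close>, this holds for every \<open>\<beta> > \<Phi>(q)\<close>, not only for large \<open>\<beta>\<close>. The exponent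
  \<open>\<psi>\<close> comes from conditioning on \<open>V\<^sub>t = n\<close> and from the iterated Poisson generating function;
  uniqueness of the scale function is injectivity of the Laplace transform on right-continuous
  functions.\<close>

section \<open>Uniqueness of scale functions\<close>

text \<open>The exponent is \<open>c * \<theta> + \<sigma>\<^sup>2 * \<theta>\<^sup>2 / 2\<close>
  minus the integral of \<open>1 - exp (- \<theta> * x)\<close> against \<open>l * exp (- l)\<close>
  times \<open>G_kernel\<close>, so that density is the intensity of the jump sizes. Its total mass
  is \<open>l * (1 - exp (- l))\<close>; hence \<open>c\<close> times the kernel at x \<ge> 0 is q
  plus the rate of jumps larger than x, which is the origin of the kernel. The scale function is the
  inverse transform of a geometric series in D E.

  Two kinds of convergence have to be kept apart. Transforms in the extended reals need only
  nonnegativity and measurability, but \<open>conv\<close> and the series are real-valued and carry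
  junk values on divergence, so pointwise control is needed as well. It comes from the bound
  \<open>K ^ Suc m * x ^ m / fact m\<close> for convolution powers of a kernel bounded by K, where
  neither K nor x has to be small. In the uniqueness argument a competing scale function may change
  sign, so Bochner integrals are used there.\<close>

text \<open>Under the substitution \<open>u = exp (- x)\<close>, vanishing Laplace transforms at the naturals are
  vanishing moments, so Weierstrass approximation applies.\<close>

lemma integral_continuous_exp_eq_0:
  fixes f \<phi> :: "real \<Rightarrow> real"
  assumes f: "integrable lborel f" and f0: "\<And>x. x < 0 \<Longrightarrow> f x = 0"
    and mom: "\<And>n::nat. (\<integral>x. exp (- x) ^ n * f x \<partial>lborel) = 0"
    and \<phi>: "continuous_on {0..1} \<phi>" and [measurable]: "\<phi> \<in> borel_measurable borel"
  shows "(\<integral>x. \<phi> (exp (- x)) * f x \<partial>lborel) = 0"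
proof -
  have [measurable]: "f \<in> borel_measurable borel" using f by auto
  \<comment> \<open>A bound for \<open>h\<close> on [0,1] suffices: \<open>exp (- x)\<close> leaves
    that interval only for x < 0, where \<open>f\<close> vanishes.\<close>
  have int: "integrable lborel (\<lambda>x. h (exp (- x)) * f x)"
    if [measurable]: "h \<in> borel_measurable borel" and b: "\<And>u. u \<in> {0..1} \<Longrightarrow> \<bar>h u\<bar> \<le> b" for h b
  proof (rule Bochner_Integration.integrable_bound[where f = "\<lambda>x. b * f x"])
    show "AE x in lborel. norm (h (exp (- x)) * f x) \<le> norm (b * f x)"
    proof (rule AE_I2)
      fix x
      show "norm (h (exp (- x)) * f x) \<le> norm (b * f x)"
        using b[of "exp (- x)"] f0[of x] by (cases "x < 0") (auto simp: abs_mult intro!: mult_right_mono)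
    qed
  qed (use f in auto)
  have eps: "\<bar>\<integral>x. \<phi> (exp (- x)) * f x \<partial>lborel\<bar> \<le> e * (\<integral>x. \<bar>f x\<bar> \<partial>lborel)" if "e > 0" for e
  proof -
    obtain p where p: "real_polynomial_function p" and pe: "\<And>u. u \<in> {0..1} \<Longrightarrow> \<bar>\<phi> u - p u\<bar> < e"
      using Stone_Weierstrass_real_polynomial_function[OF _ \<phi> \<open>e > 0\<close>] by auto
    obtain a n where pa: "p = (\<lambda>u. \<Sum>i\<le>n. a i * u ^ i)"
      using p real_polynomial_function_iff_sum by blast
    have [measurable]: "p \<in> borel_measurable borel" unfolding pa by measurable
    have ip: "integrable lborel (\<lambda>x. exp (- x) ^ i * f x)" for i
      by (rule int[where b = 1 and h = "\<lambda>u. u ^ i"]) (auto intro: power_le_one)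
    have p0: "(\<integral>x. p (exp (- x)) * f x \<partial>lborel) = 0"
    proof -
      have "(\<integral>x. p (exp (- x)) * f x \<partial>lborel) = (\<integral>x. (\<Sum>i\<le>n. a i * (exp (- x) ^ i * f x)) \<partial>lborel)"
        unfolding pa by (simp add: sum_distrib_right mult.assoc)
      also have "\<dots> = (\<Sum>i\<le>n. a i * (\<integral>x. exp (- x) ^ i * f x \<partial>lborel))"
        by (subst Bochner_Integration.integral_sum) (use ip in auto)
      finally show ?thesis using mom by simp
    qed
    have i1: "integrable lborel (\<lambda>x. (\<phi> (exp (- x)) - p (exp (- x))) * f x)"
      by (rule int[where b = e and h = "\<lambda>u. \<phi> u - p u"]) (use pe in \<open>auto intro: less_imp_le\<close>)
    have i2: "integrable lborel (\<lambda>x. p (exp (- x)) * f x)"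
      unfolding pa sum_distrib_right mult.assoc
      by (intro Bochner_Integration.integrable_sum integrable_mult_right ip)
    have "(\<integral>x. \<phi> (exp (- x)) * f x \<partial>lborel) =
        (\<integral>x. (\<phi> (exp (- x)) - p (exp (- x))) * f x + p (exp (- x)) * f x \<partial>lborel)"
      by (simp add: algebra_simps)
    also have "\<dots> = (\<integral>x. (\<phi> (exp (- x)) - p (exp (- x))) * f x \<partial>lborel)"
      using i1 i2 p0 by simp
    finally have eq: "(\<integral>x. \<phi> (exp (- x)) * f x \<partial>lborel) = \<dots>" .
    have "\<bar>\<integral>x. (\<phi> (exp (- x)) - p (exp (- x))) * f x \<partial>lborel\<bar> \<le>
        (\<integral>x. \<bar>(\<phi> (exp (- x)) - p (exp (- x))) * f x\<bar> \<partial>lborel)"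
      by (rule integral_abs_bound)
    also have "\<dots> \<le> (\<integral>x. e * \<bar>f x\<bar> \<partial>lborel)"
    proof (rule integral_mono)
      fix x
      show "\<bar>(\<phi> (exp (- x)) - p (exp (- x))) * f x\<bar> \<le> e * \<bar>f x\<bar>"
        using pe[of "exp (- x)"] f0[of x]
        by (cases "x < 0") (auto simp: abs_mult intro!: mult_right_mono)
    qed (use i1 f in auto)
    finally show ?thesis unfolding eq by simp
  qed
  have "((\<lambda>e. e * (\<integral>x. \<bar>f x\<bar> \<partial>lborel)) \<longlongrightarrow> 0 * (\<integral>x. \<bar>f x\<bar> \<partial>lborel)) (at_right 0)"
    by (intro tendsto_intros)
  then have "\<bar>\<integral>x. \<phi> (exp (- x)) * f x \<partial>lborel\<bar> \<le> 0 * (\<integral>x. \<bar>f x\<bar> \<partial>lborel)"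
    by (rule tendsto_lowerbound)
      (use eps in \<open>auto simp: eventually_at_right_field intro!: exI[of _ 1]\<close>)
  then show ?thesis by simp
qed

text \<open>In the variable u = exp (- x) the set x < a is u > exp (- a). Its indicator is the limit
  of continuous ramps of slope k starting at exp (- a) and capped at 1, and |f| dominates.\<close>

lemma integral_lessThan_eq_0:
  fixes f :: "real \<Rightarrow> real"
  assumes f: "integrable lborel f" and f0: "\<And>x. x < 0 \<Longrightarrow> f x = 0"
    and mom: "\<And>n::nat. (\<integral>x. exp (- x) ^ n * f x \<partial>lborel) = 0"
  shows "(\<integral>x. indicator {..<a} x * f x \<partial>lborel) = 0"
proof -
  have [measurable]: "f \<in> borel_measurable borel" using f by auto
  define \<phi> where "\<phi> k u = min 1 (real k * max 0 (u - exp (- a)))" for k u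
  have m[measurable]: "\<phi> k \<in> borel_measurable borel" for k
    unfolding \<phi>_def by measurable
  have lim: "(\<lambda>k. \<phi> k (exp (- x))) \<longlonglongrightarrow> indicator {..<a} x" for x
  proof (cases "x < a")
    case True
    then have d: "exp (- x) - exp (- a) > 0" by simp
    then obtain n where n: "real n * (exp (- x) - exp (- a)) > 1"
      using ex_less_of_nat_mult by blast
    have "\<phi> k (exp (- x)) = 1" if "k \<ge> n" for k
    proof -
      have "real n * (exp (- x) - exp (- a)) \<le> real k * (exp (- x) - exp (- a))"
        using that d by (intro mult_right_mono) auto
      then have "1 \<le> real k * (exp (- x) - exp (- a))" using n by linarith
      then show ?thesis using d by (simp add: \<phi>_def min_absorb1)
    qed
    then have "\<forall>\<^sub>F k in sequentially. \<phi> k (exp (- x)) = 1"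
      unfolding eventually_sequentially by blast
    then show ?thesis using True by (simp add: tendsto_eventually)
  next
    case False
    then show ?thesis by (simp add: \<phi>_def)
  qed
  have "(\<lambda>k. \<integral>x. \<phi> k (exp (- x)) * f x \<partial>lborel) \<longlonglongrightarrow> (\<integral>x. indicator {..<a} x * f x \<partial>lborel)"
  proof (rule integral_dominated_convergence[where w = "\<lambda>x. \<bar>f x\<bar>"])
    show "AE x in lborel. (\<lambda>k. \<phi> k (exp (- x)) * f x) \<longlonglongrightarrow> indicator {..<a} x * f x"
      by (intro AE_I2 tendsto_mult lim tendsto_const)
    show "AE x in lborel. norm (\<phi> k (exp (- x)) * f x) \<le> \<bar>f x\<bar>" for k
      by (intro AE_I2) (auto simp: abs_mult \<phi>_def intro!: mult_left_le_one_le)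
  qed (use f in auto)
  moreover have "(\<integral>x. \<phi> k (exp (- x)) * f x \<partial>lborel) = 0" for k
    by (rule integral_continuous_exp_eq_0[OF f f0 mom])
      (auto simp: \<phi>_def intro!: continuous_intros)
  ultimately show ?thesis by (simp add: LIMSEQ_const_iff)
qed

text \<open>A nonzero value would persist in sign on some [x,b), making the integral there nonzero,
  while it is a difference of two vanishing integrals over half-lines.\<close>

lemma right_continuous_eq_0_if_moments_eq_0:
  fixes f :: "real \<Rightarrow> real"
  assumes f: "integrable lborel f" and f0: "\<And>x. x < 0 \<Longrightarrow> f x = 0"
    and mom: "\<And>n::nat. (\<integral>x. exp (- x) ^ n * f x \<partial>lborel) = 0"
    and rc: "(f \<longlongrightarrow> f x) (at_right x)"
  shows "f x = 0"
proof (rule ccontr)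
  assume "f x \<noteq> 0"
  \<comment> \<open>Multiplying by the value at x treats both signs at once.\<close>
  define v where "v = f x"
  have v: "v * v > 0" using \<open>f x \<noteq> 0\<close> by (auto simp: v_def zero_less_mult_iff)
  have "((\<lambda>y. v * f y) \<longlongrightarrow> v * v) (at_right x)"
    unfolding v_def by (intro tendsto_intros rc)
  then have "\<forall>\<^sub>F y in at_right x. v * f y > v * v / 2"
    by (rule order_tendstoD(1)) (use v in simp)
  then obtain b where b: "b > x" "\<And>y. x < y \<Longrightarrow> y < b \<Longrightarrow> v * f y > v * v / 2"
    unfolding eventually_at_right_field by blast
  have int: "integrable lborel (\<lambda>y. indicator A y * f y)" if "A \<in> sets borel" for A :: "real set"
    using f integrable_real_mult_indicator[of A lborel f] that by (simp add: mult.commute)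
  have "0 < (b - x) * (v * v / 2)" using b v by simp
  also have "\<dots> = (\<integral>y. indicator {x..<b} y * (v * v / 2) \<partial>lborel)" using b by simp
  also have "\<dots> \<le> (\<integral>y. v * (indicator {x..<b} y * f y) \<partial>lborel)"
  proof (rule integral_mono)
    fix y
    show "indicator {x..<b} y * (v * v / 2) \<le> v * (indicator {x..<b} y * f y)"
      using b(2)[of y] v by (cases "y = x") (auto simp: indicator_def v_def)
    show "integrable lborel (\<lambda>y. indicator {x..<b} y * (v * v / 2))"
      using b by (intro integrable_mult_left integrable_real_indicator) auto
  qed (use int[of "{x..<b}"] in auto)
  also have "\<dots> = v * (\<integral>y. indicator {..<b} y * f y - indicator {..<x} y * f y \<partial>lborel)"
    using b by (auto intro!: arg_cong[where f = "(*) v"] Bochner_Integration.integral_cong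
        simp: indicator_def)
  also have "\<dots> = 0"
    using int integral_lessThan_eq_0[OF f f0 mom] by simp
  finally show False by simp
qed

lemma is_scale_function_unique:
  assumes W: "is_scale_function \<psi> q W" and W': "is_scale_function \<psi> q W'"
  shows "W = W'"
proof
  fix x
  show "W x = W' x"
  proof (cases "x < 0")
    case True
    then show ?thesis using W W' by (simp add: is_scale_function_def)
  next
    case False
    \<comment> \<open>The shift by 1 puts \<open>b\<close> inside the open half-line where the
      transforms are known, so \<open>f\<close> is integrable; its n-th moment is the difference of
      the two transforms at \<open>b + n\<close>.\<close>
    define b where "b = right_inverse \<psi> q + 1"
    define f where "f x = indicator {0..} x * (exp (- b * x) * (W x - W' x))" for x
    have A: "integrable lborel (\<lambda>x. indicator {0..} x * (exp (- \<beta> * x) * U x)) \<and>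
        (\<integral>x. indicator {0..} x * (exp (- \<beta> * x) * U x) \<partial>lborel) = 1 / (\<psi> \<beta> - q)"
      if "\<beta> > right_inverse \<psi> q" "is_scale_function \<psi> q U" for \<beta> U
      using that unfolding is_scale_function_def set_integrable_def set_lebesgue_integral_def
      by auto
    have B: "integrable lborel (\<lambda>x. indicator {0..} x * (exp (- \<beta> * x) * (W x - W' x))) \<and>
        (\<integral>x. indicator {0..} x * (exp (- \<beta> * x) * (W x - W' x)) \<partial>lborel) = 0"
      if "\<beta> > right_inverse \<psi> q" for \<beta>
      using A[OF that W] A[OF that W'] by (simp add: right_diff_distrib)
    have "f x = 0"
    proof (rule right_continuous_eq_0_if_moments_eq_0[where f = f])
      show "integrable lborel f" unfolding f_def using B[of b] by (simp add: b_def)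
      show "f x = 0" if "x < 0" for x using that by (simp add: f_def)
      show "(\<integral>x. exp (- x) ^ n * f x \<partial>lborel) = 0" for n :: nat
      proof -
        have "exp (- x) ^ n * f x = indicator {0..} x * (exp (- (b + n) * x) * (W x - W' x))" for x
        proof -
          have "exp (- x) ^ n * exp (- b * x) = exp (- (b + n) * x)"
            by (simp add: exp_of_nat_mult[symmetric] exp_add[symmetric] algebra_simps)
          then show ?thesis by (simp add: f_def mult.left_commute mult.assoc[symmetric])
        qed
        then show ?thesis using B[of "b + n"] by (simp add: b_def)
      qed
      have "((\<lambda>x. exp (- b * x) * (W x - W' x)) \<longlongrightarrow> exp (- b * x) * (W x - W' x)) (at_right x)"
        using W W' False unfolding is_scale_function_def
        by (intro tendsto_intros) (auto intro: tendsto_intros)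
      then show "(f \<longlongrightarrow> f x) (at_right x)"
        using False
        by (auto simp: f_def eventually_at_right_field
            elim!: Lim_transform_eventually intro!: exI[of _ "x + 1"])
    qed
    then show ?thesis using False by (simp add: f_def)
  qed
qed

section \<open>Convolution and Laplace transform of nonnegative functions\<close>

text \<open>Nonnegativity is what Tonelli and monotone convergence need. Boundedness on each
  half-line x \<le> a makes every convolution integral finite without integrability over the whole
  line, and convolution preserves it.\<close>

definition causal :: "(real \<Rightarrow> real) \<Rightarrow> bool" where
  "causal f \<longleftrightarrow> f \<in> borel_measurable borel \<and> (\<forall>x. 0 \<le> f x) \<and> (\<forall>x<0. f x = 0) \<and>
     (\<forall>a. \<exists>C. \<forall>x\<le>a. f x \<le> C)"

lemma causalD:
  assumes "causal f"
  shows "f \<in> borel_measurable borel" "0 \<le> f x" "x < 0 \<Longrightarrow> f x = 0"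
  using assms by (auto simp: causal_def)

lemma causal_bound:
  assumes "causal f"
  obtains C where "C \<ge> 0" "\<And>x. x \<le> a \<Longrightarrow> f x \<le> C"
proof -
  obtain C where "\<And>x. x \<le> a \<Longrightarrow> f x \<le> C" using assms unfolding causal_def by meson
  then show ?thesis using that[of C] causalD(2)[OF assms, of a] by force
qed

lemma conv_eq_integral:
  assumes "causal f" "causal g"
  shows "conv f g x = (\<integral>y. f (x - y) * g y \<partial>lborel)"
  unfolding conv_def set_lebesgue_integral_def
proof (rule Bochner_Integration.integral_cong)
  fix y
  show "indicator {0..x} y *\<^sub>R (f (x - y) * g y) = f (x - y) * g y"
    using causalD(3)[OF assms(1), of "x - y"] causalD(3)[OF assms(2), of y]
    by (cases "y < 0 \<or> x < y") auto
qed simp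

lemma integrable_const_indicator_Icc: "integrable lborel (\<lambda>y. C * indicator {a..b::real} y :: real)"
  by (intro integrable_mult_right integrable_real_indicator) (auto simp: emeasure_lborel_Icc_eq)

lemma conv_integrable:
  assumes f: "causal f" and g: "causal g"
  shows "integrable lborel (\<lambda>y. f (x - y) * g y)"
proof -
  note [measurable] = causalD(1)[OF f] causalD(1)[OF g]
  obtain C where C: "C \<ge> 0" "\<And>y. y \<le> x \<Longrightarrow> f y \<le> C" using causal_bound[OF f] by blast
  obtain D where D: "D \<ge> 0" "\<And>y. y \<le> x \<Longrightarrow> g y \<le> D" using causal_bound[OF g] by blast
  show ?thesis
  proof (rule Bochner_Integration.integrable_bound[where f = "\<lambda>y. C * D * indicator {0..x} y"])
    show "AE y in lborel. norm (f (x - y) * g y) \<le> norm (C * D * indicator {0..x} y)"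
      using C D causalD(2)[OF f] causalD(2)[OF g]
      by (intro AE_I2) (auto simp: indicator_def causalD(3)[OF f] causalD(3)[OF g]
          intro!: mult_mono)
  qed (rule integrable_const_indicator_Icc, simp)
qed

text \<open>Integrability rules out the default value 0 of the Bochner integral behind
  \<open>conv\<close>.\<close>

lemma ennreal_conv:
  assumes "causal f" "causal g"
  shows "ennreal (conv f g x) = (\<integral>\<^sup>+y. ennreal (f (x - y) * g y) \<partial>lborel)"
  unfolding conv_eq_integral[OF assms]
  by (rule nn_integral_eq_integral[symmetric])
    (use conv_integrable[OF assms] causalD(2)[OF assms(1)] causalD(2)[OF assms(2)] in auto)

lemma conv_le:
  assumes f: "causal f" and g: "causal g" and h: "integrable lborel h"
    and le: "\<And>y. 0 \<le> y \<Longrightarrow> y \<le> x \<Longrightarrow> f (x - y) * g y \<le> h y" and h0: "\<And>y. 0 \<le> h y"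
  shows "conv f g x \<le> (\<integral>y. h y \<partial>lborel)"
  unfolding conv_eq_integral[OF f g]
proof (rule integral_mono[OF conv_integrable[OF f g] h])
  fix y
  show "f (x - y) * g y \<le> h y"
    using le[of y] h0[of y] causalD(3)[OF f, of "x - y"] causalD(3)[OF g, of y]
    by (cases "0 \<le> y \<and> y \<le> x") auto
qed

lemma causal_conv:
  assumes f: "causal f" and g: "causal g"
  shows "causal (conv f g)"
  unfolding causal_def
proof (intro conjI allI impI)
  note [measurable] = causalD(1)[OF f] causalD(1)[OF g]
  have "conv f g = (\<lambda>x. \<integral>y. f (x - y) * g y \<partial>lborel)"
    using conv_eq_integral[OF f g] by auto
  then show "conv f g \<in> borel_measurable borel" by simp
  show "0 \<le> conv f g x" for x
    unfolding conv_eq_integral[OF f g] using causalD(2)[OF f] causalD(2)[OF g] by auto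
  show "conv f g x = 0" if "x < 0" for x using that by (simp add: conv_def set_lebesgue_integral_def)
  show "\<exists>C. \<forall>x\<le>a. conv f g x \<le> C" for a
  proof -
    obtain C where C: "C \<ge> 0" "\<And>y. y \<le> a \<Longrightarrow> f y \<le> C" using causal_bound[OF f] by blast
    obtain D where D: "D \<ge> 0" "\<And>y. y \<le> a \<Longrightarrow> g y \<le> D" using causal_bound[OF g] by blast
    have "conv f g x \<le> (\<integral>y. C * D * indicator {0..a} y \<partial>lborel)" if "x \<le> a" for x
      by (rule conv_le[OF f g integrable_const_indicator_Icc]) (use C D that causalD(2)[OF f] causalD(2)[OF g] in
          \<open>auto simp: indicator_def intro!: mult_mono\<close>)
    then show ?thesis by blast
  qed
qed

text \<open>Integrating over the whole line is harmless, since causal functions vanish on the negatives; it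
  makes the substitution in the convolution theorem a plain translation.\<close>

definition laplace :: "(real \<Rightarrow> real) \<Rightarrow> real \<Rightarrow> ennreal" where
  "laplace f \<beta> = (\<integral>\<^sup>+x. ennreal (exp (- \<beta> * x) * f x) \<partial>lborel)"

text \<open>The exponential factor splits as exp (- \<beta> (x - y)) exp (- \<beta> y), so Tonelli
  and translation invariance finish the proof. No condition on \<beta> is needed since both sides
  may be infinite.\<close>

lemma laplace_conv:
  assumes f: "causal f" and g: "causal g"
  shows "laplace (conv f g) \<beta> = laplace f \<beta> * laplace g \<beta>"
proof -
  note [measurable] = causalD(1)[OF f] causalD(1)[OF g]
  let ?F = "\<lambda>x. exp (- \<beta> * x) * f x" and ?G = "\<lambda>x. exp (- \<beta> * x) * g x"
  have shift: "(\<integral>\<^sup>+x. ennreal (?F (x - y)) \<partial>lborel) = laplace f \<beta>" for y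
    unfolding laplace_def
    using nn_integral_real_affine[of "\<lambda>x. ennreal (?F x)" 1 "- y"] by simp
  have "laplace (conv f g) \<beta> = (\<integral>\<^sup>+x. \<integral>\<^sup>+y. ennreal (?F (x - y)) * ennreal (?G y) \<partial>lborel \<partial>lborel)"
    unfolding laplace_def
  proof (rule nn_integral_cong)
    fix x
    have "ennreal (exp (- \<beta> * x) * conv f g x) =
        (\<integral>\<^sup>+y. ennreal (exp (- \<beta> * x)) * ennreal (f (x - y) * g y) \<partial>lborel)"
      by (simp add: ennreal_mult' ennreal_conv[OF f g] nn_integral_cmult)
    also have "\<dots> = (\<integral>\<^sup>+y. ennreal (?F (x - y)) * ennreal (?G y) \<partial>lborel)"
    proof (rule nn_integral_cong)
      fix y
      have "exp (- \<beta> * x) * (f (x - y) * g y) = ?F (x - y) * ?G y"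
        by (simp add: right_diff_distrib exp_diff exp_minus field_simps)
      then show "ennreal (exp (- \<beta> * x)) * ennreal (f (x - y) * g y) =
          ennreal (?F (x - y)) * ennreal (?G y)"
        using causalD(2)[OF f] causalD(2)[OF g] by (simp add: ennreal_mult[symmetric])
    qed
    finally show "ennreal (exp (- \<beta> * x) * conv f g x) = \<dots>" .
  qed
  also have "\<dots> = (\<integral>\<^sup>+y. \<integral>\<^sup>+x. ennreal (?F (x - y)) * ennreal (?G y) \<partial>lborel \<partial>lborel)"
    by (rule lborel_pair.Fubini'[symmetric]) simp
  also have "\<dots> = (\<integral>\<^sup>+y. laplace f \<beta> * ennreal (?G y) \<partial>lborel)"
    by (subst nn_integral_multc) (simp, simp only: shift)
  also have "\<dots> = laplace f \<beta> * laplace g \<beta>"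
    unfolding laplace_def[of g] by (rule nn_integral_cmult) simp
  finally show ?thesis .
qed

lemma laplace_cmult:
  assumes "causal f" "a \<ge> 0"
  shows "laplace (\<lambda>x. a * f x) \<beta> = ennreal a * laplace f \<beta>"
proof -
  note [measurable] = causalD(1)[OF assms(1)]
  have "laplace (\<lambda>x. a * f x) \<beta> = (\<integral>\<^sup>+x. ennreal a * ennreal (exp (- \<beta> * x) * f x) \<partial>lborel)"
    unfolding laplace_def using assms(2) causalD(2)[OF assms(1)]
    by (simp add: ennreal_mult[symmetric] mult.left_commute)
  then show ?thesis unfolding laplace_def by (simp add: nn_integral_cmult)
qed

lemma laplace_add:
  assumes "causal f" "causal g"
  shows "laplace (\<lambda>x. f x + g x) \<beta> = laplace f \<beta> + laplace g \<beta>"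
proof -
  note [measurable] = causalD(1)[OF assms(1)] causalD(1)[OF assms(2)]
  show ?thesis
    unfolding laplace_def using causalD(2)[OF assms(1)] causalD(2)[OF assms(2)]
    by (subst nn_integral_add[symmetric]) (auto simp: distrib_left)
qed

lemma laplace_suminf:
  assumes f: "\<And>n. causal (f n)" and s: "\<And>x. summable (\<lambda>n. f n x)"
  shows "laplace (\<lambda>x. \<Sum>n. f n x) \<beta> = (\<Sum>n. laplace (f n) \<beta>)"
proof -
  note [measurable] = causalD(1)[OF f]
  have "ennreal (exp (- \<beta> * x) * (\<Sum>n. f n x)) = (\<Sum>n. ennreal (exp (- \<beta> * x) * f n x))" for x
  proof -
    have "summable (\<lambda>n. exp (- \<beta> * x) * f n x)" by (intro summable_mult s)
    then show ?thesis
      using s[of x] causalD(2)[OF f]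
      by (simp add: suminf_mult[symmetric] suminf_ennreal2)
  qed
  then show ?thesis unfolding laplace_def by (simp add: nn_integral_suminf)
qed

lemma laplace_eq_ennrealD:
  assumes f: "causal f" and L: "laplace f \<beta> = ennreal v" and v: "v \<ge> 0"
  shows "set_integrable lborel {0..} (\<lambda>x. exp (- \<beta> * x) * f x)"
    and "(LINT x:{0..}|lborel. exp (- \<beta> * x) * f x) = v"
proof -
  note [measurable] = causalD(1)[OF f]
  have eq: "indicator {0..} x *\<^sub>R (exp (- \<beta> * x) * f x) = exp (- \<beta> * x) * f x" for x
    by (auto simp: indicator_def causalD(3)[OF f])
  show "set_integrable lborel {0..} (\<lambda>x. exp (- \<beta> * x) * f x)"
    unfolding set_integrable_def eq
    using L causalD(2)[OF f] by (intro integrableI_nonneg) (auto simp: laplace_def)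
  show "(LINT x:{0..}|lborel. exp (- \<beta> * x) * f x) = v"
    unfolding set_lebesgue_integral_def eq
    using L causalD(2)[OF f] v
    by (subst integral_eq_nn_integral) (auto simp: laplace_def)
qed

section \<open>Step function, Erlang densities and series of causal functions\<close>

lemma causal_unit_step: "causal unit_step"
  by (auto simp: causal_def unit_step_def indicator_def intro!: exI[of _ 1])

text \<open>Exponential tilting turns the Erlang density of rate k into a multiple of the one of
  rate k + \<beta>, whose mass (its moment of order 0) is 1.\<close>

lemma laplace_erlang_density:
  assumes "k > 0" "\<beta> > - k"
  shows "laplace (erlang_density n k) \<beta> = ennreal ((k / (k + \<beta>)) ^ Suc n)"
proof -
  have "exp (- \<beta> * x) * erlang_density n k x = (k / (k + \<beta>)) ^ Suc n * erlang_density n (k + \<beta>) x" for x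
  proof -
    have "exp (- \<beta> * x) * exp (- k * x) = exp (- (k + \<beta>) * x)"
      by (simp add: exp_add[symmetric] algebra_simps)
    moreover have "(k / (k + \<beta>)) ^ Suc n * (k + \<beta>) ^ Suc n = k ^ Suc n"
      using assms by (simp add: power_mult_distrib[symmetric] del: power_Suc)
    ultimately show ?thesis
      unfolding erlang_density_def by (simp del: power_Suc) (metis mult.assoc mult.left_commute)
  qed
  then have "laplace (erlang_density n k) \<beta> =
      (\<integral>\<^sup>+x. ennreal ((k / (k + \<beta>)) ^ Suc n) * ennreal (erlang_density n (k + \<beta>) x) \<partial>lborel)"
    unfolding laplace_def using assms by (simp add: ennreal_mult[symmetric] del: power_Suc)
  also have "\<dots> = ennreal ((k / (k + \<beta>)) ^ Suc n)"
    using nn_integral_erlang_ith_moment[of "k + \<beta>" n 0] assms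
    by (subst nn_integral_cmult) auto
  finally show ?thesis .
qed

lemma laplace_unit_step:
  assumes "\<beta> > 0"
  shows "laplace unit_step \<beta> = ennreal (1 / \<beta>)"
proof -
  have "exp (- \<beta> * x) * unit_step x = 1 / \<beta> * erlang_density 0 \<beta> x" for x
    using assms by (auto simp: erlang_density_def unit_step_def)
  then have "laplace unit_step \<beta> = (\<integral>\<^sup>+x. ennreal (1 / \<beta>) * ennreal (erlang_density 0 \<beta> x) \<partial>lborel)"
    unfolding laplace_def using assms by (simp add: ennreal_mult[symmetric])
  then show ?thesis
    using nn_integral_erlang_ith_moment[of \<beta> 0 0] assms by (simp add: nn_integral_cmult)
qed

text \<open>One term of the exponential series is at most its sum. The bound is uniform in n, so a
  single constant serves for all terms of the series to come.\<close>

lemma erlang_density_le: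
  assumes "k > 0"
  shows "erlang_density n k x \<le> k"
proof (cases "x < 0")
  case False
  have "(k * x) ^ n / fact n \<le> exp (k * x)"
  proof -
    have "(\<Sum>i\<in>{n}. (k * x) ^ i /\<^sub>R fact i) \<le> (\<Sum>i. (k * x) ^ i /\<^sub>R fact i)"
      by (rule sum_le_suminf[OF summable_exp_generic]) (use False assms in auto)
    then show ?thesis by (simp add: exp_def divide_inverse mult.commute)
  qed
  then have "(k * x) ^ n / fact n * exp (- (k * x)) \<le> 1"
    using mult_right_mono[of _ "exp (k * x)" "exp (- (k * x))"] by (force simp: exp_minus field_simps)
  then have "k * ((k * x) ^ n / fact n * exp (- (k * x))) \<le> k * 1"
    using assms by (intro mult_left_mono) auto
  then show ?thesis using False by (simp add: erlang_density_def power_mult_distrib mult.assoc field_simps)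
qed (use assms in \<open>auto simp: erlang_density_def\<close>)

lemma causal_erlang_density: "k > 0 \<Longrightarrow> causal (erlang_density n k)"
  unfolding causal_def
  by (intro conjI allI impI exI[of _ k] erlang_density_le) (auto simp: erlang_density_def)

lemma causal_cmult:
  assumes "causal f" "a \<ge> 0"
  shows "causal (\<lambda>x. a * f x)"
  unfolding causal_def
proof (intro conjI allI impI)
  note [measurable] = causalD(1)[OF assms(1)]
  show "(\<lambda>x. a * f x) \<in> borel_measurable borel" by measurable
  show "\<exists>C. \<forall>x\<le>b. a * f x \<le> C" for b
    using causal_bound[OF assms(1), of b] assms(2) by (metis mult_left_mono)
qed (use assms causalD[OF assms(1)] in auto)

lemma causal_suminf:
  assumes f: "\<And>n. causal (f n)" and b: "\<And>a. summable (b a)"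
    and le: "\<And>n x a. x \<le> a \<Longrightarrow> f n x \<le> b a n"
  shows "summable (\<lambda>n. f n x)" and "causal (\<lambda>x. \<Sum>n. f n x)"
proof -
  show s: "summable (\<lambda>n. f n x)" for x
    by (rule summable_comparison_test'[OF b[of x], where N = 0]) (use le[of x x] causalD(2)[OF f] in auto)
  note [measurable] = causalD(1)[OF f]
  have "(\<Sum>n. f n x) \<le> (\<Sum>n. b a n)" if "x \<le> a" for a x
    by (intro suminf_le s b le that)
  then show "causal (\<lambda>x. \<Sum>n. f n x)"
    unfolding causal_def using causalD(2,3)[OF f] s by (auto intro!: suminf_nonneg)
qed

section \<open>Convolution powers and their factorial bounds\<close>

lemma causal_conv_power:
  assumes "causal f"
  shows "causal ((conv f ^^ m) f)"
  by (induction m) (use assms causal_conv in auto)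

lemma laplace_conv_power:
  assumes "causal f"
  shows "laplace ((conv f ^^ m) f) \<beta> = laplace f \<beta> ^ Suc m"
  by (induction m) (use assms laplace_conv causal_conv_power in auto)

text \<open>The estimate of iterated Volterra kernels: each convolution integrates
  \<open>y ^ m\<close> over [0,x], and the factor 1 / (m + 1) gained there builds up the
  factorial.\<close>

lemma conv_power_le:
  assumes f: "causal f" and K: "\<And>x. f x \<le> K" and "x \<ge> 0"
  shows "(conv f ^^ m) f x \<le> K ^ Suc m * x ^ m / fact m"
  using \<open>x \<ge> 0\<close>
proof (induction m arbitrary: x)
  case 0
  then show ?case using K by simp
next
  case (Suc m)
  let ?p = "(conv f ^^ m) f"
  have K0: "K \<ge> 0" using K[of 0] causalD(2)[OF f, of 0] by simp
  have hb: "has_bochner_integral lborel (\<lambda>y. y ^ m * indicator {0..x} y) (x ^ Suc m / Suc m)"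
    unfolding has_bochner_integral_iff
  proof
    show "integrable lborel (\<lambda>y. y ^ m * indicator {0..x} y)"
      by (rule borel_integrable_atLeastAtMost) auto
    show "(\<integral>y. y ^ m * indicator {0..x} y \<partial>lborel) = x ^ Suc m / Suc m"
      using integral_power[OF Suc.prems, of m] by simp
  qed
  have "conv f ?p x \<le> (\<integral>y. K ^ Suc (Suc m) / fact m * (y ^ m * indicator {0..x} y) \<partial>lborel)"
  proof (rule conv_le[OF f causal_conv_power[OF f]])
    show "integrable lborel (\<lambda>y. K ^ Suc (Suc m) / fact m * (y ^ m * indicator {0..x} y))"
      by (intro integrable_mult_right) (use hb in \<open>auto simp: has_bochner_integral_iff\<close>)
    fix y assume y: "0 \<le> y" "y \<le> x"
    have "f (x - y) * ?p y \<le> K * (K ^ Suc m * y ^ m / fact m)"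
      by (intro mult_mono K Suc.IH y causalD(2)[OF causal_conv_power[OF f]] K0)
    then show "f (x - y) * ?p y \<le> K ^ Suc (Suc m) / fact m * (y ^ m * indicator {0..x} y)"
      using y by (simp add: algebra_simps)
  qed (use K0 in \<open>auto simp: indicator_def\<close>)
  also have "\<dots> = K ^ Suc (Suc m) / fact m * (x ^ Suc m / Suc m)"
    using hb by (simp only: integral_mult_right_zero has_bochner_integral_iff)
  finally show ?case by (simp add: field_simps)
qed

lemma causal_conv_power_conv:
  assumes "causal f" "causal g"
  shows "causal (conv_power_conv f n g)"
  unfolding conv_power_conv_def using assms causal_conv causal_conv_power
  by (auto split: nat.split)

lemma laplace_conv_power_conv:
  assumes "causal f" "causal g"
  shows "laplace (conv_power_conv f n g) \<beta> = laplace f \<beta> ^ n * laplace g \<beta>"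
  unfolding conv_power_conv_def
  using assms laplace_conv[OF causal_conv_power[OF assms(1)] assms(2)] laplace_conv_power[OF assms(1)]
  by (auto split: nat.split)

text \<open>The last convolution, with \<open>g\<close>, uses only the constant bound k: it
  contributes the length |a| but no new factorial, hence \<open>fact (n - 1)\<close>. For n = 0 the
  truncated subtraction gives \<open>fact 0\<close>, which is the right value. The absolute value
  covers a < 0.\<close>

lemma conv_power_conv_le:
  assumes f: "causal f" and g: "causal g" and K: "\<And>x. f x \<le> K" and k: "\<And>x. g x \<le> k"
    and a: "x \<le> a"
  shows "conv_power_conv f n g x \<le> k * ((K * \<bar>a\<bar>) ^ n / fact (n - 1))"
proof (cases n)
  case 0
  then show ?thesis using k by (simp add: conv_power_conv_def)
next
  case (Suc m)
  let ?p = "(conv f ^^ m) f"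
  have K0: "K \<ge> 0" using K[of 0] causalD(2)[OF f, of 0] by simp
  have k0: "k \<ge> 0" using k[of 0] causalD(2)[OF g, of 0] by simp
  have "conv ?p g x \<le> (\<integral>y. K ^ Suc m * \<bar>a\<bar> ^ m / fact m * k * indicator {0..\<bar>a\<bar>} y \<partial>lborel)"
  proof (rule conv_le[OF causal_conv_power[OF f] g integrable_const_indicator_Icc])
    fix y assume y: "0 \<le> y" "y \<le> x"
    have "?p (x - y) \<le> K ^ Suc m * (x - y) ^ m / fact m"
      by (rule conv_power_le[OF f K]) (use y in simp)
    also have "\<dots> \<le> K ^ Suc m * \<bar>a\<bar> ^ m / fact m"
      by (intro divide_right_mono mult_left_mono power_mono) (use y a K0 in auto)
    finally have "?p (x - y) * g y \<le> K ^ Suc m * \<bar>a\<bar> ^ m / fact m * k"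
      by (intro mult_mono k causalD(2)[OF g]) (use K0 in auto)
    then show "?p (x - y) * g y \<le> K ^ Suc m * \<bar>a\<bar> ^ m / fact m * k * indicator {0..\<bar>a\<bar>} y"
      using y a by simp
  qed (use K0 k0 in auto)
  also have "\<dots> = K ^ Suc m * \<bar>a\<bar> ^ m / fact m * k * \<bar>a\<bar>" by simp
  finally show ?thesis
    using Suc by (simp add: conv_power_conv_def power_mult_distrib field_simps)
qed

lemma summable_power_over_fact_pred: "summable (\<lambda>n. k * (y ^ n / fact (n - 1)) :: real)"
proof (intro summable_mult)
  have "summable (\<lambda>n. y * (y ^ n /\<^sub>R fact n))"
    by (intro summable_mult summable_exp_generic)
  then have "summable (\<lambda>n. y ^ Suc n / fact (Suc n - 1))"
    by (simp add: divide_inverse mult.commute mult.left_commute)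
  then show "summable (\<lambda>n. y ^ n / fact (n - 1))"
    by (subst (asm) summable_Suc_iff)
qed

text \<open>Convolving with the step function gives the running integral of \<open>f\<close>, which
  is nondecreasing and, as \<open>f\<close> is locally bounded, grows by at most C (y - x).\<close>

lemma conv_unit_step_right_continuous:
  assumes f: "causal f"
  shows "(conv unit_step f \<longlongrightarrow> conv unit_step f x) (at_right x)"
proof -
  obtain C where C: "C \<ge> 0" "\<And>y. y \<le> x + 1 \<Longrightarrow> f y \<le> C" using causal_bound[OF f] by blast
  note int = conv_integrable[OF causal_unit_step f]
  have up: "conv unit_step f y - conv unit_step f x \<le> C * (y - x) \<and>
      conv unit_step f x \<le> conv unit_step f y" if y: "x < y" "y < x + 1" for y
  proof
    have "conv unit_step f y - conv unit_step f x =
        (\<integral>z. unit_step (y - z) * f z - unit_step (x - z) * f z \<partial>lborel)"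
      unfolding conv_eq_integral[OF causal_unit_step f] using int by simp
    also have "\<dots> \<le> (\<integral>z. C * indicator {x..y} z \<partial>lborel)"
      by (rule integral_mono) (use int integrable_const_indicator_Icc C y in
          \<open>auto simp: unit_step_def indicator_def\<close>)
    finally show "conv unit_step f y - conv unit_step f x \<le> C * (y - x)" using y by simp
    show "conv unit_step f x \<le> conv unit_step f y"
      unfolding conv_eq_integral[OF causal_unit_step f]
      by (rule integral_mono[OF int int])
        (use y causalD(2)[OF f] in \<open>auto simp: unit_step_def indicator_def\<close>)
  qed
  have ev: "\<forall>\<^sub>F y in at_right x. x < y \<and> y < x + 1"
    by (auto simp: eventually_at_right_field intro!: exI[of _ "x + 1"])
  have "((\<lambda>y. conv unit_step f x + C * (y - x)) \<longlongrightarrow> conv unit_step f x + C * (x - x)) (at_right x)"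
    by (intro tendsto_intros)
  then have lim: "((\<lambda>y. conv unit_step f x + C * (y - x)) \<longlongrightarrow> conv unit_step f x) (at_right x)"
    by simp
  show ?thesis
  proof (rule tendsto_sandwich[OF _ _ tendsto_const lim])
    show "\<forall>\<^sub>F y in at_right x. conv unit_step f x \<le> conv unit_step f y"
      using ev by eventually_elim (use up in auto)
    show "\<forall>\<^sub>F y in at_right x. conv unit_step f y \<le> conv unit_step f x + C * (y - x)"
      using ev by eventually_elim (use up in \<open>auto simp: algebra_simps\<close>)
  qed
qed

section \<open>The kernel and the series\<close>

definition risk_exponent :: "real \<Rightarrow> real \<Rightarrow> real \<Rightarrow> real \<Rightarrow> real \<Rightarrow> real" where
  "risk_exponent l \<delta> c \<sigma> \<theta> = c * \<theta> - l + l * exp (- l + l * \<delta> / (\<delta> + \<theta>)) + \<sigma>\<^sup>2 * \<theta>\<^sup>2 / 2"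

text \<open>Agrees with \<open>G_kernel\<close> except at \<open>0\<close>, where \<open>G_kernel\<close> has a junk value. As a mixture of
  Erlang densities it can be transformed termwise.\<close>

definition G_series :: "real \<Rightarrow> real \<Rightarrow> real \<Rightarrow> real" where
  "G_series \<delta> l x = (\<Sum>n. l ^ Suc n / fact (Suc n) * erlang_density n \<delta> x)"

text \<open>The two series agree term by term. With s = sqrt (\<delta> l x), the odd power s^(2k+1)
  is s (\<delta> l x)^k, and the leftover s cancels \<open>sqrt x\<close> in the denominator,
  leaving \<delta> l.\<close>

lemma G_kernel_eq_G_series:
  assumes "\<delta> > 0" "l > 0" "x \<noteq> 0"
  shows "G_kernel \<delta> l x = G_series \<delta> l x"
proof (cases "x < 0")
  case True
  then show ?thesis by (simp add: G_kernel_def G_series_def erlang_density_def)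
next
  case False
  then have x: "x > 0" using assms by simp
  define s where "s = sqrt (\<delta> * l * x)"
  have s2: "s * s = \<delta> * l * x" and s0: "s > 0"
    using assms x by (auto simp: s_def)
  have "s / sqrt x = sqrt (\<delta> * l)" using x by (simp add: s_def real_sqrt_mult)
  then have "sqrt (\<delta> * l) * (s / sqrt x) = \<delta> * l" using assms by simp
  then have sx: "sqrt (\<delta> * l) * s / sqrt x = \<delta> * l" by simp
  let ?a = "\<lambda>k. (2 * s / 2) ^ (2 * k + 1) / (fact k * fact (k + 1))"
  let ?C = "exp (- \<delta> * x) * sqrt (\<delta> * l) / sqrt x"
  have term_eq: "l ^ Suc k / fact (Suc k) * erlang_density k \<delta> x = ?C * ?a k" for k
  proof -
    have "s ^ (2 * k + 1) = s * (\<delta> * l * x) ^ k"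
      by (simp add: power_mult power2_eq_square s2)
    then have a: "?a k = s * (\<delta> * l * x) ^ k / (fact k * fact (Suc k))"
      by (simp del: fact_Suc)
    \<comment> \<open>Stated for arbitrary reals, so that the roots and factorials stay opaque
      during the rearrangement.\<close>
    have "E * r / q * (s * P / (f * g)) = (r * s / q * P) * E / (g * f)" for E r q P f g :: real
      by (simp add: divide_inverse mult_ac)
    then have "?C * ?a k = (sqrt (\<delta> * l) * s / sqrt x * (\<delta> * l * x) ^ k) * exp (- \<delta> * x) /
        (fact (Suc k) * fact k)"
      unfolding a .
    then have A: "?C * ?a k = (\<delta> * l * (\<delta> * l * x) ^ k) * exp (- \<delta> * x) / (fact (Suc k) * fact k)"
      unfolding sx .
    have B: "\<delta> * l * (\<delta> * l * x) ^ k = l ^ Suc k * (\<delta> ^ Suc k * x ^ k)"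
      by (simp only: power_mult_distrib power_Suc mult_ac)
    have e: "erlang_density k \<delta> x = \<delta> ^ Suc k * x ^ k * exp (- \<delta> * x) / fact k"
      using x by (simp add: erlang_density_def)
    show ?thesis
      unfolding A B e by (simp only: times_divide_times_eq mult.assoc)
  qed
  have "summable ?a"
  proof (rule summable_comparison_test'[where N = 0])
    show "summable (\<lambda>k. s * ((s * s) ^ k /\<^sub>R fact k))"
      by (intro summable_mult summable_exp_generic)
    fix k :: nat
    have "?a k = s * (s * s) ^ k / (fact k * fact (k + 1))"
      by (simp add: power_mult power2_eq_square)
    also have "\<dots> \<le> s * (s * s) ^ k / (fact k * 1)"
      using s0 fact_ge_1[of "k + 1", where 'a = real] by (intro divide_left_mono mult_left_mono mult_pos_pos) auto
    also have "s * (s * s) ^ k / (fact k * 1) = s * ((s * s) ^ k /\<^sub>R fact k)"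
      by (simp add: divide_inverse)
    finally have "?a k \<le> s * ((s * s) ^ k /\<^sub>R fact k)" .
    moreover have "norm (?a k) = ?a k"
      unfolding real_norm_def by (rule abs_of_nonneg) (use s0 in simp)
    ultimately show "norm (?a k) \<le> s * ((s * s) ^ k /\<^sub>R fact k)" by simp
  qed
  then have "?C * (\<Sum>k. ?a k) = (\<Sum>k. ?C * ?a k)" by (rule suminf_mult[symmetric])
  then have "?C * (\<Sum>k. ?a k) = G_series \<delta> l x" unfolding G_series_def term_eq .
  moreover have "G_kernel \<delta> l x = ?C * (\<Sum>k. ?a k)"
    using x by (simp add: G_kernel_def bessel_I_def s_def)
  ultimately show ?thesis by simp
qed

lemma risk_exponent_minus:
  "risk_exponent l \<delta> c \<sigma> \<beta> - q =
     (c * \<beta> + \<sigma>\<^sup>2 * \<beta>\<^sup>2 / 2) - (l + q - l * exp (- l + l * \<delta> / (\<delta> + \<beta>)))"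
  unfolding risk_exponent_def by simp

lemma exp_sums_Suc: "(\<lambda>n. y ^ Suc n / fact (Suc n)) sums (exp y - 1 :: real)"
proof -
  have "(\<lambda>n. y ^ n / fact n) sums exp y"
    using exp_converges[of y] by (simp add: divide_inverse mult.commute)
  then show ?thesis by (subst sums_Suc_iff) simp
qed

context
  fixes \<delta> l :: real
  assumes \<delta>: "\<delta> > 0" and l: "l > 0"
begin

text \<open>The Erlang transforms are powers of \<delta> / (\<delta> + \<beta>), so the weighted sum
  is an exponential series without its constant term. The case \<beta> = 0 is included: it gives the
  total mass.\<close>

lemma
  shows causal_G_series: "causal (G_series \<delta> l)"
    and laplace_G_series: "\<beta> \<ge> 0 \<Longrightarrow> laplace (G_series \<delta> l) \<beta> = ennreal (exp (l * \<delta> / (\<delta> + \<beta>)) - 1)"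
proof -
  let ?f = "\<lambda>n x. l ^ Suc n / fact (Suc n) * erlang_density n \<delta> x"
  have c: "causal (?f n)" for n
    by (rule causal_cmult[OF causal_erlang_density[OF \<delta>]]) (use l in simp)
  have b: "summable (\<lambda>n. l ^ Suc n / fact (Suc n) * \<delta>)"
    by (intro summable_mult2 sums_summable[OF exp_sums_Suc])
  have le: "?f n x \<le> l ^ Suc n / fact (Suc n) * \<delta>" for n x
    by (intro mult_left_mono erlang_density_le[OF \<delta>]) (use l in simp)
  show "causal (G_series \<delta> l)"
    using causal_suminf(2)[of ?f "\<lambda>_ n. l ^ Suc n / fact (Suc n) * \<delta>", OF c b le]
    unfolding G_series_def .
  assume \<beta>: "\<beta> \<ge> 0"
  have ft: "laplace (?f n) \<beta> = ennreal ((l * \<delta> / (\<delta> + \<beta>)) ^ Suc n / fact (Suc n))" for n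
  proof -
    have "laplace (?f n) \<beta> = ennreal (l ^ Suc n / fact (Suc n)) * ennreal ((\<delta> / (\<delta> + \<beta>)) ^ Suc n)"
      using laplace_cmult[OF causal_erlang_density[OF \<delta>], of "l ^ Suc n / fact (Suc n)" n \<beta>]
        laplace_erlang_density[OF \<delta>, of \<beta> n] \<beta> \<delta> l by simp
    also have "\<dots> = ennreal (l ^ Suc n / fact (Suc n) * (\<delta> / (\<delta> + \<beta>)) ^ Suc n)"
      by (rule ennreal_mult[symmetric]) (use l \<delta> \<beta> in auto)
    also have "l ^ Suc n / fact (Suc n) * (\<delta> / (\<delta> + \<beta>)) ^ Suc n = (l * \<delta> / (\<delta> + \<beta>)) ^ Suc n / fact (Suc n)"
      by (simp add: power_mult_distrib power_divide del: fact_Suc power_Suc)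
    finally show ?thesis .
  qed
  have "laplace (G_series \<delta> l) \<beta> = (\<Sum>n. laplace (?f n) \<beta>)"
    unfolding G_series_def
    by (rule laplace_suminf[of ?f, OF c causal_suminf(1)[of ?f "\<lambda>_ n. l ^ Suc n / fact (Suc n) * \<delta>", OF c b le]])
  also have "\<dots> = (\<Sum>n. ennreal ((l * \<delta> / (\<delta> + \<beta>)) ^ Suc n / fact (Suc n)))"
    by (rule suminf_cong) (rule ft)
  also have "\<dots> = ennreal (exp (l * \<delta> / (\<delta> + \<beta>)) - 1)"
    using exp_sums_Suc[of "l * \<delta> / (\<delta> + \<beta>)"] l \<delta> \<beta>
    by (subst suminf_ennreal_eq) auto
  finally show "laplace (G_series \<delta> l) \<beta> = ennreal (exp (l * \<delta> / (\<delta> + \<beta>)) - 1)" .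
qed

text \<open>The two kernels can differ only at 0, a null set.\<close>

lemma conv_G_kernel: "conv unit_step (G_kernel \<delta> l) = conv unit_step (G_series \<delta> l)"
proof
  fix x
  note [measurable] = causalD(1)[OF causal_unit_step] causalD(1)[OF causal_G_series]
  have "AE y in lborel. y \<noteq> (0::real)" by (rule AE_lborel_singleton)
  then have ae: "AE y in lborel. G_kernel \<delta> l y = G_series \<delta> l y"
    by eventually_elim (rule G_kernel_eq_G_series[OF \<delta> l])
  have "G_kernel \<delta> l = (\<lambda>y. if y = 0 then G_kernel \<delta> l 0 else G_series \<delta> l y)"
    using G_kernel_eq_G_series[OF \<delta> l] by auto
  also have "\<dots> \<in> borel_measurable borel" by measurable
  finally have [measurable]: "G_kernel \<delta> l \<in> borel_measurable borel" .
  show "conv unit_step (G_kernel \<delta> l) x = conv unit_step (G_series \<delta> l) x"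
    unfolding conv_def set_lebesgue_integral_def
    by (rule integral_cong_AE) (use ae in auto)
qed

lemma conv_unit_step_G_series_le: "conv unit_step (G_series \<delta> l) x \<le> exp l - 1"
proof -
  have "ennreal (conv unit_step (G_series \<delta> l) x) \<le> laplace (G_series \<delta> l) 0"
    unfolding ennreal_conv[OF causal_unit_step causal_G_series] laplace_def
    by (intro nn_integral_mono ennreal_leI)
      (use causalD(2)[OF causal_G_series] in \<open>auto simp: unit_step_def indicator_def\<close>)
  then show ?thesis
    using laplace_G_series[of 0] l \<delta> by (auto simp: ennreal_le_iff)
qed

section \<open>Sign and transform of the kernel\<close>

context
  fixes c q :: real
  assumes c: "c > 0" and q: "q \<ge> 0"
begin

lemma digamma_kernel_eq:
  "digamma_kernel l \<delta> c q z = (l * (1 - exp (- l)) + q) / c * unit_step z -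
     l * exp (- l) / c * conv unit_step (G_series \<delta> l) z"
  unfolding digamma_kernel_def conv_G_kernel ..

lemma digamma_kernel_le: "digamma_kernel l \<delta> c q z \<le> (l * (1 - exp (- l)) + q) / c"
proof -
  have "0 \<le> l * exp (- l) / c * conv unit_step (G_series \<delta> l) z"
    using l c causalD(2)[OF causal_conv[OF causal_unit_step causal_G_series]] by simp
  moreover have "(l * (1 - exp (- l)) + q) / c * unit_step z \<le> (l * (1 - exp (- l)) + q) / c * 1"
    using l c q by (intro mult_left_mono) (auto simp: unit_step_def indicator_def)
  ultimately show ?thesis unfolding digamma_kernel_eq by simp
qed

lemma causal_digamma_kernel: "causal (digamma_kernel l \<delta> c q)"
  unfolding causal_def
proof (intro conjI allI impI)
  note cc = causal_conv[OF causal_unit_step causal_G_series]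
  note [measurable] = causalD(1)[OF causal_unit_step] causalD(1)[OF cc]
  show "digamma_kernel l \<delta> c q \<in> borel_measurable borel"
    unfolding digamma_kernel_eq[abs_def] by measurable
  show "\<exists>C. \<forall>x\<le>a. digamma_kernel l \<delta> c q x \<le> C" for a
    using digamma_kernel_le by blast
  show z: "digamma_kernel l \<delta> c q x = 0" if "x < 0" for x
    unfolding digamma_kernel_eq using that causalD(3)[OF cc] by (simp add: unit_step_def)
  show "0 \<le> digamma_kernel l \<delta> c q x" for x
  proof (cases "x < 0")
    case False
    have "l * exp (- l) / c * conv unit_step (G_series \<delta> l) x \<le> l * exp (- l) / c * (exp l - 1)"
      using l c by (intro mult_left_mono conv_unit_step_G_series_le) auto
    \<comment> \<open>The coefficient times the total mass of G is exactly the part of the constant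
      that does not contain q, so the kernel is at least q / c on the half-line.\<close>
    also have "\<dots> = l * (1 - exp (- l)) / c" by (simp add: exp_minus field_simps)
    also have "\<dots> \<le> (l * (1 - exp (- l)) + q) / c" using c q by (simp add: divide_right_mono)
    finally show ?thesis unfolding digamma_kernel_eq using False by (simp add: unit_step_def)
  qed (simp add: z)
qed

text \<open>Differences are unreliable in the extended reals, so the subtracted part is added back
  and only sums are transformed; finiteness of the right-hand side then makes the transform a real
  d. The product \<open>c * \<beta> * d\<close> is the form in which it enters
  \<open>risk_exponent_minus\<close>.\<close>

lemma laplace_digamma_kernel:
  assumes \<beta>: "\<beta> > 0"
  shows "\<exists>d\<ge>0. laplace (digamma_kernel l \<delta> c q) \<beta> = ennreal d \<and>
           c * \<beta> * d = l + q - l * exp (- l + l * \<delta> / (\<delta> + \<beta>))"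
proof -
  let ?D = "digamma_kernel l \<delta> c q" and ?K = "(l * (1 - exp (- l)) + q) / c" and ?a = "l * exp (- l) / c"
  let ?u = "?a * (1 / \<beta> * (exp (l * \<delta> / (\<delta> + \<beta>)) - 1))"
  have K: "?K \<ge> 0" and a: "?a \<ge> 0" using l c q by auto
  note cc = causal_conv[OF causal_unit_step causal_G_series]
  have g: "exp (l * \<delta> / (\<delta> + \<beta>)) - 1 \<ge> 0" using l \<delta> \<beta> by simp
  have "laplace (\<lambda>x. ?D x + ?a * conv unit_step (G_series \<delta> l) x) \<beta> = laplace (\<lambda>x. ?K * unit_step x) \<beta>"
    by (simp add: digamma_kernel_eq)
  then have "laplace ?D \<beta> + ennreal ?a * (ennreal (1 / \<beta>) * ennreal (exp (l * \<delta> / (\<delta> + \<beta>)) - 1)) =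
      ennreal ?K * ennreal (1 / \<beta>)"
    using \<beta> by (simp add: laplace_add[OF causal_digamma_kernel causal_cmult[OF cc a]]
        laplace_cmult[OF cc a] laplace_cmult[OF causal_unit_step K] laplace_unit_step
        laplace_conv[OF causal_unit_step causal_G_series] laplace_G_series del: times_divide_eq_left)
  also have "ennreal ?a * (ennreal (1 / \<beta>) * ennreal (exp (l * \<delta> / (\<delta> + \<beta>)) - 1)) = ennreal ?u"
    using g a \<beta> by (simp only: ennreal_mult[symmetric] mult_nonneg_nonneg zero_le_divide_1_iff less_imp_le)
  also have "ennreal ?K * ennreal (1 / \<beta>) = ennreal (?K * (1 / \<beta>))"
    using K \<beta> by (simp only: ennreal_mult[symmetric] zero_le_divide_1_iff less_imp_le)
  finally have eq: "laplace ?D \<beta> + ennreal ?u = ennreal (?K * (1 / \<beta>))" .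
  have u: "?u \<ge> 0" using g a \<beta> by (intro mult_nonneg_nonneg) auto
  obtain d where d: "laplace ?D \<beta> = ennreal d" "d \<ge> 0"
    using eq by (cases "laplace ?D \<beta>") auto
  then have "ennreal (d + ?u) = ennreal (?K * (1 / \<beta>))" using eq u by (simp only: ennreal_plus)
  then have "d + ?u = ?K * (1 / \<beta>)"
    by (subst (asm) ennreal_inj) (use d(2) u K \<beta> in \<open>auto intro: divide_nonneg_pos simp del: divide_divide_eq_left\<close>)
  then have "c * \<beta> * (d + ?u) = c * \<beta> * (?K * (1 / \<beta>))" by simp
  also have "\<dots> = l * (1 - exp (- l)) + q" using c \<beta> by simp
  also have "c * \<beta> * (d + ?u) = c * \<beta> * d + l * exp (- l) * (exp (l * \<delta> / (\<delta> + \<beta>)) - 1)"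
    using c \<beta> by (simp add: distrib_left)
  finally have "c * \<beta> * d = l + q - l * (exp (- l) * exp (l * \<delta> / (\<delta> + \<beta>)))"
    by (simp add: algebra_simps)
  then show ?thesis using d unfolding exp_add by blast
qed

section \<open>The transform of the series and the range of its validity\<close>

context
  fixes \<sigma> :: real
  assumes \<sigma>: "\<sigma> > 0"
begin

lemma erlang_rate_pos: "2 * c / \<sigma>\<^sup>2 > 0" using c \<sigma> by simp

lemma causal_scale_term: "causal (scale_term l \<delta> c \<sigma> q n)"
  unfolding scale_term_def
  by (intro causal_conv_power_conv causal_digamma_kernel causal_erlang_density erlang_rate_pos)

lemma
  shows summable_scale_term: "summable (\<lambda>n. scale_term l \<delta> c \<sigma> q n x)"
    and causal_suminf_scale_term: "causal (\<lambda>x. \<Sum>n. scale_term l \<delta> c \<sigma> q n x)"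
proof -
  let ?k = "2 * c / \<sigma>\<^sup>2" and ?K = "(l * (1 - exp (- l)) + q) / c"
  have le: "scale_term l \<delta> c \<sigma> q n x \<le> ?k * ((?K * \<bar>a\<bar>) ^ n / fact (n - 1))" if "x \<le> a" for n x a
    unfolding scale_term_def
    by (rule conv_power_conv_le[OF causal_digamma_kernel causal_erlang_density[OF erlang_rate_pos]
          digamma_kernel_le erlang_density_le[OF erlang_rate_pos] that])
  note * = causal_suminf[of "scale_term l \<delta> c \<sigma> q" "\<lambda>a n. ?k * ((?K * \<bar>a\<bar>) ^ n / fact (n - 1))",
      OF causal_scale_term summable_power_over_fact_pred le]
  show "summable (\<lambda>n. scale_term l \<delta> c \<sigma> q n x)" by (rule *(1))
  show "causal (\<lambda>x. \<Sum>n. scale_term l \<delta> c \<sigma> q n x)" by (rule *(2))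
qed

lemma laplace_suminf_scale_term:
  assumes \<beta>: "\<beta> > 0" and pos: "risk_exponent l \<delta> c \<sigma> \<beta> > q"
  shows "laplace (\<lambda>x. \<Sum>n. scale_term l \<delta> c \<sigma> q n x) \<beta> = ennreal (c * \<beta> / (risk_exponent l \<delta> c \<sigma> \<beta> - q))"
proof -
  let ?k = "2 * c / \<sigma>\<^sup>2"
  obtain d where d: "d \<ge> 0" "laplace (digamma_kernel l \<delta> c q) \<beta> = ennreal d"
    "c * \<beta> * d = l + q - l * exp (- l + l * \<delta> / (\<delta> + \<beta>))"
    using laplace_digamma_kernel[OF \<beta>] by auto
  define e where "e = ?k / (?k + \<beta>)"
  have e: "e > 0" unfolding e_def by (intro divide_pos_pos add_pos_pos erlang_rate_pos \<beta>)
  \<comment> \<open>This fixes the Erlang rate: with rate 2c / \<sigma>^2 the transform e is c / (c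
    + \<sigma>^2 \<beta> / 2), so dividing \<open>c * \<beta>\<close> by e yields the drift and
    Gaussian parts of the exponent.\<close>
  have ce: "c * \<beta> = e * (c * \<beta> + \<sigma>\<^sup>2 * \<beta>\<^sup>2 / 2)"
  proof -
    have "c + \<sigma>\<^sup>2 * \<beta> / 2 = c / e"
    proof -
      have ck: "c / ?k = \<sigma>\<^sup>2 / 2" using c \<sigma> by simp
      have "c / e = c * (?k + \<beta>) / ?k" unfolding e_def by (rule divide_divide_eq_right)
      also have "\<dots> = c / ?k * (?k + \<beta>)" by (rule times_divide_eq_left[symmetric])
      also have "\<dots> = c + \<sigma>\<^sup>2 / 2 * \<beta>" unfolding ck using \<sigma> by (simp add: distrib_left)
      finally show ?thesis by simp
    qed
    then have "e * (c + \<sigma>\<^sup>2 * \<beta> / 2) * \<beta> = c * \<beta>" using e by simp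
    then show ?thesis by (simp add: algebra_simps power2_eq_square)
  qed
  have key: "e * (risk_exponent l \<delta> c \<sigma> \<beta> - q) = c * \<beta> * (1 - d * e)"
    unfolding risk_exponent_minus d(3)[symmetric] right_diff_distrib ce[symmetric] by simp
  \<comment> \<open>Here positivity of exponent minus q becomes convergence of the geometric
    series.\<close>
  have "c * \<beta> * (1 - d * e) > 0" unfolding key[symmetric] using e pos by simp
  then have "1 - d * e > 0" by (rule zero_less_mult_pos) (use c \<beta> in simp)
  then have de: "d * e < 1" by simp
  have st: "laplace (scale_term l \<delta> c \<sigma> q n) \<beta> = ennreal ((d * e) ^ n * e)" for n
  proof -
    have "laplace (scale_term l \<delta> c \<sigma> q n) \<beta> = ennreal d ^ n * ennreal (e ^ Suc n)"
      using laplace_erlang_density[OF erlang_rate_pos, of \<beta> n] erlang_rate_pos \<beta> d(2)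
      unfolding scale_term_def e_def
      by (subst laplace_conv_power_conv[OF causal_digamma_kernel causal_erlang_density[OF erlang_rate_pos]]) simp
    also have "\<dots> = ennreal (d ^ n * e ^ Suc n)"
      using d(1) e by (simp only: ennreal_power ennreal_mult zero_le_power less_imp_le)
    finally show ?thesis by (simp add: power_mult_distrib mult_ac)
  qed
  have "laplace (\<lambda>x. \<Sum>n. scale_term l \<delta> c \<sigma> q n x) \<beta> = (\<Sum>n. laplace (scale_term l \<delta> c \<sigma> q n) \<beta>)"
    by (rule laplace_suminf[OF causal_scale_term summable_scale_term])
  also have "\<dots> = (\<Sum>n. ennreal ((d * e) ^ n * e))"
    by (rule suminf_cong) (rule st)
  also have "\<dots> = ennreal (1 / (1 - d * e) * e)"
    using sums_mult2[OF geometric_sums, of "d * e" e] d(1) e de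
    by (intro suminf_ennreal_eq) (auto simp: abs_mult)
  also have "1 / (1 - d * e) * e = c * \<beta> / (risk_exponent l \<delta> c \<sigma> \<beta> - q)"
    using key pos de by (simp add: field_simps)
  finally show ?thesis .
qed

text \<open>The intermediate value theorem replaces convexity: the exponent is continuous and
  bounded below by a line of slope c > 0, so wherever it is at most q, a root lies at or to the
  right of that point. At 0 this makes the set of roots nonempty, so that its supremum is
  meaningful; at \<beta> it contradicts that \<beta> exceeds every root.\<close>

lemma risk_exponent_gt:
  assumes \<psi>: "\<And>\<theta>. \<theta> \<ge> 0 \<Longrightarrow> \<psi> \<theta> = risk_exponent l \<delta> c \<sigma> \<theta>"
    and \<beta>: "\<beta> > right_inverse \<psi> q"
  shows "\<beta> > 0" and "\<psi> \<beta> > q"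
proof -
  let ?r = "risk_exponent l \<delta> c \<sigma>"
  let ?S = "{\<theta>. 0 \<le> \<theta> \<and> \<psi> \<theta> = q}"
  have cont: "continuous_on {0..} ?r"
    unfolding risk_exponent_def using \<delta> by (intro continuous_intros) auto
  have lower: "c * \<theta> - l \<le> ?r \<theta>" if "\<theta> \<ge> 0" for \<theta>
    unfolding risk_exponent_def using l by simp
  have bdd: "bdd_above ?S"
  proof (rule bdd_aboveI)
    fix \<theta> assume "\<theta> \<in> ?S"
    then show "\<theta> \<le> (q + l) / c" using lower[of \<theta>] \<psi>[of \<theta>] c by (auto simp: field_simps)
  qed
  have root: "\<exists>\<theta>\<ge>a. \<theta> \<in> ?S" if a: "a \<ge> 0" "?r a \<le> q" for a
  proof -
    \<comment> \<open>The line \<open>c * \<theta> - l\<close> reaches q at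
      \<open>(q + l) / c\<close>.\<close>
    define b where "b = max a ((q + l) / c)"
    have "c * ((q + l) / c) \<le> c * b" using c by (intro mult_left_mono) (auto simp: b_def)
    then have "q \<le> ?r b" using lower[of b] a c by (simp add: b_def le_max_iff_disj)
    then obtain \<theta> where "a \<le> \<theta>" "\<theta> \<le> b" "?r \<theta> = q"
      using IVT'[of ?r a q b] a continuous_on_subset[OF cont, of "{a..b}"] by (auto simp: b_def)
    then show ?thesis using a \<psi>[of \<theta>] by auto
  qed
  have le: "\<theta> \<le> right_inverse \<psi> q" if "\<theta> \<in> ?S" for \<theta>
    unfolding right_inverse_def by (rule cSup_upper[OF that bdd])
  \<comment> \<open>The exponent vanishes at 0.\<close>
  have "?r 0 \<le> q" using \<delta> q by (simp add: risk_exponent_def)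
  then obtain \<theta> where "\<theta> \<in> ?S" using root[of 0] by auto
  then show pos: "\<beta> > 0" using le[of \<theta>] \<beta> by auto
  show "\<psi> \<beta> > q"
  proof (rule ccontr)
    assume "\<not> \<psi> \<beta> > q"
    then obtain \<theta> where "\<theta> \<ge> \<beta>" "\<theta> \<in> ?S" using root[of \<beta>] pos \<psi>[of \<beta>] by auto
    then show False using le[of \<theta>] \<beta> by simp
  qed
qed

lemma is_scale_function_risk_exponent:
  assumes \<psi>: "\<And>\<theta>. \<theta> \<ge> 0 \<Longrightarrow> \<psi> \<theta> = risk_exponent l \<delta> c \<sigma> \<theta>"
  shows "is_scale_function \<psi> q
    (\<lambda>x. 1 / c * conv unit_step (\<lambda>y. \<Sum>n. scale_term l \<delta> c \<sigma> q n y) x)"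
    (is "is_scale_function \<psi> q ?W")
proof -
  note S = causal_suminf_scale_term
  note US = causal_conv[OF causal_unit_step S]
  have c1: "1 / c \<ge> 0" using c by simp
  have W: "causal ?W" by (rule causal_cmult[OF US c1])
  show ?thesis
    unfolding is_scale_function_def
  proof (intro conjI allI impI)
    show "?W x = 0" if "x < 0" for x by (rule causalD(3)[OF W that])
    show "(?W \<longlongrightarrow> ?W x) (at_right x)" for x
      by (intro tendsto_mult_left conv_unit_step_right_continuous S)
    fix \<beta> assume "right_inverse \<psi> q < \<beta>"
    then have \<beta>: "\<beta> > 0" "\<psi> \<beta> > q" using risk_exponent_gt[of \<psi>, OF \<psi>] by auto
    then have r: "\<psi> \<beta> = risk_exponent l \<delta> c \<sigma> \<beta>" using \<psi> by simp
    have "laplace ?W \<beta> = ennreal (1 / c) * (ennreal (1 / \<beta>) * ennreal (c * \<beta> / (\<psi> \<beta> - q)))"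
      unfolding laplace_cmult[OF US c1] laplace_conv[OF causal_unit_step S] laplace_unit_step[OF \<beta>(1)]
      using laplace_suminf_scale_term[OF \<beta>(1)] \<beta>(2) unfolding r by simp
    also have "\<dots> = ennreal (1 / c * (1 / \<beta> * (c * \<beta> / (\<psi> \<beta> - q))))"
      using \<beta> c by (simp add: ennreal_mult[symmetric])
    also have "1 / c * (1 / \<beta> * (c * \<beta> / (\<psi> \<beta> - q))) = 1 / (\<psi> \<beta> - q)"
      using \<beta> c by simp
    finally have L: "laplace ?W \<beta> = ennreal (1 / (\<psi> \<beta> - q))" .
    show "set_integrable lborel {0..} (\<lambda>x. exp (- \<beta> * x) * ?W x)"
      by (rule laplace_eq_ennrealD(1)[OF W L]) (use \<beta> in simp)
    show "(LINT x:{0..}|lborel. exp (- \<beta> * x) * ?W x) = 1 / (\<psi> \<beta> - q)"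
      by (rule laplace_eq_ennrealD(2)[OF W L]) (use \<beta> in simp)
  qed
qed

end
end
end

section \<open>The Laplace exponent of the risk process\<close>

text \<open>The condition 0 \<le> r is essential on the right, as \<open>ennreal\<close> sends
  negative reals to 0.\<close>

lemma integrable_integral_eq_iff_nn_integral:
  assumes [measurable]: "f \<in> borel_measurable M" and "\<And>x. 0 \<le> f x"
  shows "integrable M f \<and> (\<integral>x. f x \<partial>M) = r \<longleftrightarrow> 0 \<le> r \<and> (\<integral>\<^sup>+x. ennreal (f x) \<partial>M) = ennreal r"
proof
  assume L: "integrable M f \<and> (\<integral>x. f x \<partial>M) = r"
  then have "0 \<le> r" using assms(2) by auto
  then show "0 \<le> r \<and> (\<integral>\<^sup>+x. ennreal (f x) \<partial>M) = ennreal r"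
    using L nn_integral_eq_integral[of M f] assms(2) by auto
next
  assume R: "0 \<le> r \<and> (\<integral>\<^sup>+x. ennreal (f x) \<partial>M) = ennreal r"
  then show "integrable M f \<and> (\<integral>x. f x \<partial>M) = r"
    using assms(2) by (auto intro!: integrableI_nonneg simp: integral_eq_nn_integral)
qed

lemma laplace_exponent_eqI:
  assumes "\<And>t. 0 \<le> t \<Longrightarrow> X t \<in> borel_measurable M"
    and nn: "\<And>t. 0 \<le> t \<Longrightarrow> (\<integral>\<^sup>+\<omega>. ennreal (exp (\<theta> * X t \<omega>)) \<partial>M) = ennreal (exp (p * t))"
  shows "laplace_exponent M X \<theta> = p"
proof -
  have P: "integrable M (\<lambda>\<omega>. exp (\<theta> * X t \<omega>)) \<and> (\<integral>\<omega>. exp (\<theta> * X t \<omega>) \<partial>M) = exp (p * t)" if "t \<ge> 0" for t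
    using assms(1)[OF that]
    by (subst integrable_integral_eq_iff_nn_integral) (simp_all add: nn[OF that])
  show ?thesis
    unfolding laplace_exponent_def
  proof (rule the_equality)
    show "\<forall>t\<ge>0. integrable M (\<lambda>\<omega>. exp (\<theta> * X t \<omega>)) \<and> (\<integral>\<omega>. exp (\<theta> * X t \<omega>) \<partial>M) = exp (p * t)"
      using P by blast
    fix p' assume "\<forall>t\<ge>0. integrable M (\<lambda>\<omega>. exp (\<theta> * X t \<omega>)) \<and> (\<integral>\<omega>. exp (\<theta> * X t \<omega>) \<partial>M) = exp (p' * t)"
    then have "exp (p' * 1) = exp (p * 1)" using P[of 1] by (metis zero_le_one)
    then show "p' = p" by simp
  qed
qed

text \<open>Completing the square: tilting by exp (a x) moves the mean to a s^2 and leaves a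
  constant factor in front of a probability density.\<close>

lemma nn_integral_exp_normal_density:
  assumes "s > 0"
  shows "(\<integral>\<^sup>+x. ennreal (normal_density 0 s x) * ennreal (exp (a * x)) \<partial>lborel) = ennreal (exp (a\<^sup>2 * s\<^sup>2 / 2))"
proof -
  have sq: "normal_density 0 s x * exp (a * x) = exp (a\<^sup>2 * s\<^sup>2 / 2) * normal_density (a * s\<^sup>2) s x" for x
  proof -
    have "- x\<^sup>2 / (2 * s\<^sup>2) + a * x = a\<^sup>2 * s\<^sup>2 / 2 + - (x - a * s\<^sup>2)\<^sup>2 / (2 * s\<^sup>2)"
      using assms by (simp add: field_simps power2_eq_square)
    then have "exp (- x\<^sup>2 / (2 * s\<^sup>2)) * exp (a * x) =
        exp (a\<^sup>2 * s\<^sup>2 / 2) * exp (- (x - a * s\<^sup>2)\<^sup>2 / (2 * s\<^sup>2))"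
      by (simp only: exp_add[symmetric])
    then show ?thesis by (simp add: normal_density_def)
  qed
  have "(\<integral>\<^sup>+x. ennreal (normal_density 0 s x) * ennreal (exp (a * x)) \<partial>lborel) =
      (\<integral>\<^sup>+x. ennreal (exp (a\<^sup>2 * s\<^sup>2 / 2)) * ennreal (normal_density (a * s\<^sup>2) s x) \<partial>lborel)"
    by (rule nn_integral_cong) (simp only: ennreal_mult[symmetric] sq normal_density_nonneg exp_ge_zero)
  also have "\<dots> = ennreal (exp (a\<^sup>2 * s\<^sup>2 / 2)) * (\<integral>\<^sup>+x. ennreal (normal_density (a * s\<^sup>2) s x) \<partial>lborel)"
    by (rule nn_integral_cmult) simp
  also have "(\<integral>\<^sup>+x. ennreal (normal_density (a * s\<^sup>2) s x) \<partial>lborel) = 1"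
    using assms by (subst nn_integral_eq_integral) auto
  finally show ?thesis by simp
qed

text \<open>The family \<open>process_events\<close> packaged as a measurable space, so that
  membership of events in it can be derived by composing measurable maps.\<close>

definition process_algebra ::
    "'a measure \<Rightarrow> 'b measure \<Rightarrow> 'i set \<Rightarrow> ('i \<Rightarrow> 'a \<Rightarrow> 'b) \<Rightarrow> 'a measure" where
  "process_algebra M S I X = sigma (space M) {X i -` A \<inter> space M | i A. i \<in> I \<and> A \<in> sets S}"

lemma space_process_algebra [simp]: "space (process_algebra M S I X) = space M"
  unfolding process_algebra_def by (rule space_measure_of) auto

lemma sets_process_algebra: "sets (process_algebra M S I X) = process_events M S I X"
  unfolding process_algebra_def process_events_def by (rule sets_measure_of) auto

lemma measurable_process_algebra:
  assumes "i \<in> I" and "X i \<in> space M \<rightarrow> space S"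
  shows "X i \<in> measurable (process_algebra M S I X) S"
proof (rule measurableI)
  fix A assume "A \<in> sets S"
  then show "X i -` A \<inter> space (process_algebra M S I X) \<in> sets (process_algebra M S I X)"
    using assms(1) unfolding sets_process_algebra process_events_def
    by (auto intro!: sigma_sets.Basic)
qed (use assms in auto)

text \<open>Time 0 is treated apart because the law is prescribed only for increments with s < t. It
  cannot be skipped: when \<open>N1 t\<close> is 0, the outer process is evaluated at time
  0.\<close>

lemma (in prob_space) poisson_process_prob:
  assumes N: "poisson_process M l N" and t: "0 \<le> t" and l: "l > 0"
  shows "prob {\<omega> \<in> space M. N t \<omega> = n} = (l * t) ^ n / fact n * exp (- (l * t))"
proof -
  have [measurable]: "N t \<in> measurable M (count_space UNIV)" "N 0 \<in> measurable M (count_space UNIV)"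
    and N0: "AE \<omega> in M. N 0 \<omega> = 0"
    using N t by (auto simp: poisson_process_def)
  show ?thesis
  proof (cases "t = 0")
    case True
    have "prob {\<omega> \<in> space M. N t \<omega> = n} = (if n = 0 then 1 else 0)"
    proof (cases "n = 0")
      case True
      have "AE \<omega> in M. N t \<omega> = n" using N0 \<open>t = 0\<close> True by simp
      then show ?thesis using True by (simp add: prob_Collect_eq_1)
    next
      case False
      have "AE \<omega> in M. \<not> N t \<omega> = n" using N0 \<open>t = 0\<close> False by auto
      then show ?thesis using False by (simp add: prob_Collect_eq_0)
    qed
    then show ?thesis using True by simp
  next
    case False
    then have t: "0 < t" using t by simp
    have d: "distr M (count_space UNIV) (\<lambda>\<omega>. N t \<omega> - N 0 \<omega>) = measure_pmf (poisson_pmf (l * (t - 0)))"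
      using N t unfolding poisson_process_def by blast
    have "prob {\<omega> \<in> space M. N t \<omega> = n} = prob {\<omega> \<in> space M. N t \<omega> - N 0 \<omega> = n}"
      by (rule prob_eq_AE) (use N0 in auto)
    also have "\<dots> = measure (distr M (count_space UNIV) (\<lambda>\<omega>. N t \<omega> - N 0 \<omega>)) {n}"
      by (subst measure_distr) (auto intro!: arg_cong[where f = prob])
    also have "\<dots> = (l * t) ^ n / fact n * exp (- (l * t))"
      unfolding d using t l by (simp add: measure_pmf_single)
    finally show ?thesis .
  qed
qed

lemma suminf_poisson_pgf:
  assumes "m \<ge> 0" "s \<ge> 0"
  shows "(\<Sum>n. ennreal (m ^ n / fact n * exp (- m)) * ennreal s ^ n) = ennreal (exp (m * (s - 1)))"
proof -
  have "(\<lambda>n. (m * s) ^ n / fact n * exp (- m)) sums (exp (m * s) * exp (- m))"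
    using exp_converges[of "m * s"] by (intro sums_mult2) (simp add: divide_inverse mult.commute)
  then have "(\<Sum>n. ennreal ((m * s) ^ n / fact n * exp (- m))) = ennreal (exp (m * s) * exp (- m))"
    using assms by (intro suminf_ennreal_eq) auto
  moreover have "ennreal (m ^ n / fact n * exp (- m)) * ennreal s ^ n = ennreal ((m * s) ^ n / fact n * exp (- m))" for n
  proof -
    have "ennreal (m ^ n / fact n * exp (- m)) * ennreal s ^ n = ennreal (m ^ n / fact n * exp (- m) * s ^ n)"
      using assms by (simp only: ennreal_power, subst ennreal_mult) auto
    then show ?thesis by (simp add: power_mult_distrib mult_ac)
  qed
  ultimately show ?thesis by (simp add: exp_add[symmetric] algebra_simps)
qed

lemma suminf_swap_ennreal:
  fixes f :: "nat \<Rightarrow> nat \<Rightarrow> ennreal"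
  shows "(\<Sum>n. \<Sum>m. f m n) = (\<Sum>m. \<Sum>n. f m n)"
  using nn_integral_suminf[of "\<lambda>m n. f m n" "count_space UNIV"]
  by (simp add: nn_integral_count_space_nat)

section \<open>The twice iterated Poisson process and the exponential moments of the risk
  process\<close>

context prob_space
begin

text \<open>The random time takes countably many values, so measurability of \<open>N2\<close> at
  each fixed integer time is enough.\<close>

lemma measurable_twice_iterated:
  assumes "poisson_process M l N1" "poisson_process M l N2" "0 \<le> t"
  shows "twice_iterated N1 N2 t \<in> measurable M (count_space UNIV)"
proof -
  have [measurable]: "N1 t \<in> measurable M (count_space UNIV)"
    "\<And>m::nat. N2 (real m) \<in> measurable M (count_space UNIV)"
    using assms by (auto simp: poisson_process_def)
  show ?thesis
    unfolding twice_iterated_def[abs_def]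
    by (rule measurable_compose_countable[where g = "N1 t" and f = "\<lambda>m. N2 (real m)"]) measurable
qed

text \<open>On the event \<open>N1 t = m\<close> the outer process is read at the deterministic time
  m, and independence factors the probability.\<close>

lemma emeasure_twice_iterated:
  assumes N1: "poisson_process M l N1" and N2: "poisson_process M l N2" and l: "l > 0" and t: "0 \<le> t"
    and ind: "indep_set (process_events M (count_space UNIV) {0..} N1)
      (process_events M (count_space UNIV) {0..} N2)"
  shows "emeasure M {\<omega> \<in> space M. twice_iterated N1 N2 t \<omega> = n} =
    (\<Sum>m. ennreal ((l * t) ^ m / fact m * exp (- (l * t))) *
         ennreal ((l * m) ^ n / fact n * exp (- (l * m))))"
proof -
  have [measurable]: "N1 t \<in> measurable M (count_space UNIV)"
    "\<And>m::nat. N2 (real m) \<in> measurable M (count_space UNIV)"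
    using N1 N2 t by (auto simp: poisson_process_def)
  define A where "A m = {\<omega> \<in> space M. N1 t \<omega> = m} \<inter> {\<omega> \<in> space M. N2 (real m) \<omega> = n}" for m
  have [measurable]: "A m \<in> events" for m unfolding A_def by measurable
  have "{\<omega> \<in> space M. twice_iterated N1 N2 t \<omega> = n} = (\<Union>m. A m)"
    by (auto simp: A_def twice_iterated_def)
  moreover have "disjoint_family A" by (auto simp: A_def disjoint_family_on_def)
  ultimately have eq: "emeasure M {\<omega> \<in> space M. twice_iterated N1 N2 t \<omega> = n} = (\<Sum>m. emeasure M (A m))"
    using suminf_emeasure[of A M] by (auto simp: image_subset_iff)
  have "emeasure M (A m) = ennreal ((l * t) ^ m / fact m * exp (- (l * t))) *
         ennreal ((l * m) ^ n / fact n * exp (- (l * m)))" for m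
  proof -
    have ev: "{\<omega> \<in> space M. N s \<omega> = k} \<in> process_events M (count_space UNIV) {0..} N"
      if "s \<ge> 0" for N :: "real \<Rightarrow> 'a \<Rightarrow> nat" and s k
    proof -
      have "N s \<in> measurable (process_algebra M (count_space UNIV) {0..} N) (count_space UNIV)"
        by (rule measurable_process_algebra) (use that in auto)
      from measurable_sets[OF this, of "{k}"] show ?thesis
        by (simp add: sets_process_algebra vimage_def Collect_conj_eq Int_commute)
    qed
    have "prob (A m) = (l * t) ^ m / fact m * exp (- (l * t)) * ((l * m) ^ n / fact n * exp (- (l * m)))"
      unfolding A_def indep_setD[OF ind ev ev, OF t of_nat_0_le_iff]
      using poisson_process_prob[OF N1 t l] poisson_process_prob[OF N2 of_nat_0_le_iff l] by simp
    then show ?thesis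
      using l t by (simp only: emeasure_eq_measure, subst ennreal_mult[symmetric]) auto
  qed
  then show ?thesis unfolding eq by simp
qed

lemma pgf_twice_iterated:
  assumes N1: "poisson_process M l N1" and N2: "poisson_process M l N2" and l: "l > 0" and t: "0 \<le> t"
    and ind: "indep_set (process_events M (count_space UNIV) {0..} N1)
      (process_events M (count_space UNIV) {0..} N2)" and s: "s \<ge> 0"
  shows "(\<Sum>n. emeasure M {\<omega> \<in> space M. twice_iterated N1 N2 t \<omega> = n} * ennreal s ^ n) =
    ennreal (exp (l * t * (exp (l * (s - 1)) - 1)))"
proof -
  let ?p = "\<lambda>m. ennreal ((l * t) ^ m / fact m * exp (- (l * t)))"
  let ?r = "\<lambda>m n. ennreal ((l * real m) ^ n / fact n * exp (- (l * real m)))"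
  have "(\<Sum>n. emeasure M {\<omega> \<in> space M. twice_iterated N1 N2 t \<omega> = n} * ennreal s ^ n) =
      (\<Sum>n. \<Sum>m. ?p m * (?r m n * ennreal s ^ n))"
    unfolding emeasure_twice_iterated[OF N1 N2 l t ind] by (simp only: ennreal_suminf_multc[symmetric] mult.assoc)
  also have "\<dots> = (\<Sum>m. \<Sum>n. ?p m * (?r m n * ennreal s ^ n))"
    by (rule suminf_swap_ennreal)
  also have "\<dots> = (\<Sum>m. ?p m * (\<Sum>n. ?r m n * ennreal s ^ n))" by simp
  also have "\<dots> = (\<Sum>m. ?p m * ennreal (exp (l * real m * (s - 1))))"
    using l s by (subst suminf_poisson_pgf) auto
  \<comment> \<open>The inner generating function is an m-th power, so the outer sum is again a
    Poisson generating function, now at \<open>exp (l * (s - 1))\<close>.\<close>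
  also have "\<dots> = (\<Sum>m. ?p m * ennreal (exp (l * (s - 1))) ^ m)"
    by (simp add: ennreal_power exp_of_nat_mult[symmetric] mult_ac)
  also have "\<dots> = ennreal (exp (l * t * (exp (l * (s - 1)) - 1)))"
    using l t by (subst suminf_poisson_pgf) auto
  finally show ?thesis .
qed

text \<open>Independence is assumed for families of events, the product formula holds for random
  variables; the link is that all preimages lie in the respective families.\<close>

lemma nn_integral_indep_sets3:
  fixes X Y Z :: "'a \<Rightarrow> ennreal"
  assumes ind: "indep_sets ((!) [A, B, C]) {..<3}"
    and X: "\<And>S. S \<in> sets borel \<Longrightarrow> X -` S \<inter> space M \<in> A"
    and Y: "\<And>S. S \<in> sets borel \<Longrightarrow> Y -` S \<inter> space M \<in> B"
    and Z: "\<And>S. S \<in> sets borel \<Longrightarrow> Z -` S \<inter> space M \<in> C"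
  shows "(\<integral>\<^sup>+\<omega>. X \<omega> * Y \<omega> * Z \<omega> \<partial>M) =
    (\<integral>\<^sup>+\<omega>. X \<omega> \<partial>M) * (\<integral>\<^sup>+\<omega>. Y \<omega> \<partial>M) * (\<integral>\<^sup>+\<omega>. Z \<omega> \<partial>M)"
proof -
  have I3: "{..<3} = {0, 1, 2::nat}" by auto
  have "A \<subseteq> events" "B \<subseteq> events" "C \<subseteq> events" using ind unfolding I3 by (auto simp: indep_sets_def)
  then have m: "random_variable borel X" "random_variable borel Y" "random_variable borel Z"
    using X Y Z by (auto intro!: measurableI)
  let ?W = "(!) [X, Y, Z]"
  have "indep_vars (\<lambda>_. borel) ?W {..<3}"
    unfolding indep_vars_def2
  proof (intro conjI)
    show "\<forall>i\<in>{..<3}. random_variable borel (?W i)" unfolding I3 using m by simp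
    show "indep_sets (\<lambda>i. {?W i -` S \<inter> space M |S. S \<in> sets borel}) {..<3}"
      by (rule indep_sets_mono_sets[OF ind]) (use X Y Z in \<open>auto simp: I3\<close>)
  qed
  then have "(\<integral>\<^sup>+\<omega>. (\<Prod>i\<in>{..<3}. ?W i \<omega>) \<partial>M) = (\<Prod>i\<in>{..<3}. \<integral>\<^sup>+\<omega>. ?W i \<omega> \<partial>M)"
    by (intro indep_vars_nn_integral) auto
  then show ?thesis by (simp add: I3 mult.assoc)
qed

lemma
  fixes c \<sigma> :: real
  assumes l: "l > 0" and \<delta>: "\<delta> > 0" and t: "0 \<le> t" and \<theta>: "0 \<le> \<theta>"
    and N1: "poisson_process M l N1" and N2: "poisson_process M l N2"
    and indN: "indep_set (process_events M (count_space UNIV) {0..} N1)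
      (process_events M (count_space UNIV) {0..} N2)"
    and \<xi>: "\<And>i. i \<ge> 1 \<Longrightarrow> distributed M lborel (\<xi> i) (exponential_density \<delta>)"
    and ind\<xi>: "indep_vars (\<lambda>_. borel) \<xi> {1..}"
    and B: "brownian_motion M B"
    and ind: "indep_sets
           ((!) [process_events M (count_space UNIV) {0..} (twice_iterated N1 N2),
                 process_events M borel {1..} \<xi>,
                 process_events M borel {0..} B]) {..<3}"
  defines "R \<equiv> risk_process c \<sigma> (twice_iterated N1 N2) \<xi> B t"
  shows borel_measurable_risk_process: "R \<in> borel_measurable M"
    and nn_integral_exp_risk_process:
      "(\<integral>\<^sup>+\<omega>. ennreal (exp (\<theta> * R \<omega>)) \<partial>M) = ennreal (exp (risk_exponent l \<delta> c \<sigma> \<theta> * t))"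
proof -
  let ?V = "twice_iterated N1 N2 t"
  have [measurable]: "?V \<in> measurable M (count_space UNIV)"
    by (rule measurable_twice_iterated[OF N1 N2 t])
  have \<xi>m: "\<xi> i \<in> borel_measurable M" if "i \<ge> 1" for i
    using distributed_measurable[OF \<xi>[OF that]] by simp
  have Bm[measurable]: "B t \<in> borel_measurable M" using B t by (auto simp: brownian_motion_def)
  have sm: "(\<lambda>\<omega>. \<Sum>i=1..n. \<xi> i \<omega>) \<in> borel_measurable M" for n
    by (rule borel_measurable_sum) (use \<xi>m in auto)
  have [measurable]: "(\<lambda>\<omega>. \<Sum>i=1..?V \<omega>. \<xi> i \<omega>) \<in> borel_measurable M"
    by (rule measurable_compose_countable[where g = ?V and f = "\<lambda>n \<omega>. \<Sum>i=1..n. \<xi> i \<omega>"])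
      (use sm in auto)
  show "R \<in> borel_measurable M" unfolding R_def risk_process_def[abs_def] by measurable
  let ?X = "\<lambda>n \<omega>. indicator {n} (?V \<omega>) :: ennreal"
  let ?Y = "\<lambda>n \<omega>. (\<Prod>i\<in>{1..n}. ennreal (exp (- \<theta> * \<xi> i \<omega>)))"
  let ?Z = "\<lambda>\<omega>. ennreal (exp (\<theta> * \<sigma> * B t \<omega>))"
  let ?d = "\<delta> / (\<delta> + \<theta>)"
  have Ym[measurable]: "?Y n \<in> borel_measurable M" for n
    by (rule borel_measurable_prod_ennreal) (use \<xi>m in auto)
  \<comment> \<open>Only the summand n = \<open>?V \<omega>\<close> is nonzero. Splitting in this
    way replaces the random number of jumps by a fixed one and separates each summand into factors
    depending on one process each.\<close>
  have pw: "ennreal (exp (\<theta> * R \<omega>)) = (\<Sum>n. ennreal (exp (\<theta> * c * t)) * (?X n \<omega> * ?Y n \<omega> * ?Z \<omega>))" for \<omega>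
  proof -
    have "(\<Sum>n. ennreal (exp (\<theta> * c * t)) * (?X n \<omega> * ?Y n \<omega> * ?Z \<omega>)) =
        (\<Sum>n\<in>{?V \<omega>}. ennreal (exp (\<theta> * c * t)) * (?X n \<omega> * ?Y n \<omega> * ?Z \<omega>))"
      by (rule suminf_finite) auto
    also have "\<dots> = ennreal (exp (\<theta> * c * t)) * (?Y (?V \<omega>) \<omega> * ?Z \<omega>)" by simp
    also have "?Y (?V \<omega>) \<omega> = ennreal (exp (- \<theta> * (\<Sum>i=1..?V \<omega>. \<xi> i \<omega>)))"
      by (simp add: prod_ennreal sum_distrib_left exp_sum[symmetric] sum_negf)
    also have "ennreal (exp (\<theta> * c * t)) * (\<dots> * ?Z \<omega>) = ennreal (exp (\<theta> * R \<omega>))"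
      by (simp add: ennreal_mult[symmetric] exp_add[symmetric] R_def risk_process_def algebra_simps)
    finally show ?thesis ..
  qed
  have XYZ: "(\<lambda>\<omega>. ?X n \<omega> * ?Y n \<omega> * ?Z \<omega>) \<in> borel_measurable M" for n
  proof (intro borel_measurable_times_ennreal Ym)
    show "?X n \<in> borel_measurable M" by (rule measurable_compose[of ?V M "count_space UNIV"]) auto
    show "?Z \<in> borel_measurable M" by measurable
  qed
  have EX: "(\<integral>\<^sup>+\<omega>. ?X n \<omega> \<partial>M) = emeasure M {\<omega> \<in> space M. ?V \<omega> = n}" for n
  proof -
    have "(\<integral>\<^sup>+\<omega>. ?X n \<omega> \<partial>M) = (\<integral>\<^sup>+\<omega>. indicator {\<omega> \<in> space M. ?V \<omega> = n} \<omega> \<partial>M)"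
      by (rule nn_integral_cong) (auto simp: indicator_def)
    then show ?thesis by simp
  qed
  have EY: "(\<integral>\<^sup>+\<omega>. ?Y n \<omega> \<partial>M) = ennreal ?d ^ n" for n
  proof -
    have "indep_vars (\<lambda>_. borel) (\<lambda>i \<omega>. ennreal (exp (- \<theta> * \<xi> i \<omega>))) {1..n}"
      by (rule indep_vars_compose2[OF indep_vars_subset[OF ind\<xi>], where N = "\<lambda>_. borel"]) auto
    then have "(\<integral>\<^sup>+\<omega>. ?Y n \<omega> \<partial>M) = (\<Prod>i\<in>{1..n}. \<integral>\<^sup>+\<omega>. ennreal (exp (- \<theta> * \<xi> i \<omega>)) \<partial>M)"
      by (intro indep_vars_nn_integral) auto
    also have "\<dots> = (\<Prod>i\<in>{1..n}. ennreal ?d)"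
    proof (rule prod.cong[OF refl])
      fix i assume i: "i \<in> {1..n}"
      have "(\<integral>\<^sup>+\<omega>. ennreal (exp (- \<theta> * \<xi> i \<omega>)) \<partial>M) =
          (\<integral>\<^sup>+x. ennreal (exponential_density \<delta> x) * ennreal (exp (- \<theta> * x)) \<partial>lborel)"
        by (rule distributed_nn_integral[OF \<xi>, symmetric]) (use i in auto)
      also have "\<dots> = laplace (exponential_density \<delta>) \<theta>"
        unfolding laplace_def using \<delta>
        by (intro nn_integral_cong) (simp add: ennreal_mult[symmetric] mult.commute)
      finally show "(\<integral>\<^sup>+\<omega>. ennreal (exp (- \<theta> * \<xi> i \<omega>)) \<partial>M) = ennreal ?d"
        using laplace_erlang_density[of \<delta> \<theta> 0] \<delta> \<theta> by simp
    qed
    finally show ?thesis by simp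
  qed
  have EZ: "(\<integral>\<^sup>+\<omega>. ?Z \<omega> \<partial>M) = ennreal (exp (\<sigma>\<^sup>2 * \<theta>\<^sup>2 / 2 * t))"
  \<comment> \<open>The normal law is prescribed only for increments of positive length; at time 0
    the motion vanishes almost surely.\<close>
  proof (cases "t = 0")
    case True
    have "(\<integral>\<^sup>+\<omega>. ?Z \<omega> \<partial>M) = (\<integral>\<^sup>+\<omega>. 1 \<partial>M)"
      by (rule nn_integral_cong_AE) (use B True in \<open>auto simp: brownian_motion_def\<close>)
    then show ?thesis using True by (simp add: emeasure_space_1)
  next
    case False
    then have t: "t > 0" using t by simp
    have B0: "AE \<omega> in M. B 0 \<omega> = 0" using B by (simp add: brownian_motion_def)
    have D: "distributed M lborel (\<lambda>\<omega>. B t \<omega> - B 0 \<omega>) (normal_density 0 (sqrt (t - 0)))"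
      using B t unfolding brownian_motion_def by blast
    have "(\<integral>\<^sup>+\<omega>. ?Z \<omega> \<partial>M) = (\<integral>\<^sup>+\<omega>. ennreal (exp (\<theta> * \<sigma> * (B t \<omega> - B 0 \<omega>))) \<partial>M)"
      by (rule nn_integral_cong_AE) (use B0 in auto)
    also have "\<dots> = (\<integral>\<^sup>+x. ennreal (normal_density 0 (sqrt (t - 0)) x) * ennreal (exp (\<theta> * \<sigma> * x)) \<partial>lborel)"
      by (rule distributed_nn_integral[OF D, symmetric]) simp
    also have "\<dots> = ennreal (exp ((\<theta> * \<sigma>)\<^sup>2 * (sqrt (t - 0))\<^sup>2 / 2))"
      by (rule nn_integral_exp_normal_density) (use t in simp)
    also have "(\<theta> * \<sigma>)\<^sup>2 * (sqrt (t - 0))\<^sup>2 / 2 = \<sigma>\<^sup>2 * \<theta>\<^sup>2 / 2 * t"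
      using t by (simp add: power_mult_distrib)
    finally show ?thesis .
  qed
  have E3: "(\<integral>\<^sup>+\<omega>. ?X n \<omega> * ?Y n \<omega> * ?Z \<omega> \<partial>M) =
      (\<integral>\<^sup>+\<omega>. ?X n \<omega> \<partial>M) * (\<integral>\<^sup>+\<omega>. ?Y n \<omega> \<partial>M) * (\<integral>\<^sup>+\<omega>. ?Z \<omega> \<partial>M)" for n
  proof (rule nn_integral_indep_sets3[OF ind])
    fix S :: "ennreal set" assume S: "S \<in> sets borel"
    let ?AV = "process_algebra M (count_space UNIV) {0..} (twice_iterated N1 N2)"
    \<comment> \<open>Each factor must be measurable for the sigma-algebra of its own process;
      measurability on \<open>M\<close> alone would not give access to the independence.\<close>
    have "?V \<in> measurable ?AV (count_space UNIV)" by (rule measurable_process_algebra) (use t in auto)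
    then have "?X n \<in> borel_measurable ?AV" by (rule measurable_compose) simp
    from measurable_sets[OF this S]
    show "?X n -` S \<inter> space M \<in> process_events M (count_space UNIV) {0..} (twice_iterated N1 N2)"
      by (simp add: sets_process_algebra)
    let ?A\<xi> = "process_algebra M borel {1..} \<xi>"
    have "\<xi> i \<in> borel_measurable ?A\<xi>" if "i \<in> {1..n}" for i
      by (rule measurable_process_algebra) (use that in auto)
    then have "?Y n \<in> borel_measurable ?A\<xi>" by (intro borel_measurable_prod_ennreal) measurable
    from measurable_sets[OF this S] show "?Y n -` S \<inter> space M \<in> process_events M borel {1..} \<xi>"
      by (simp add: sets_process_algebra)
    let ?AB = "process_algebra M borel {0..} B"
    have "B t \<in> borel_measurable ?AB" by (rule measurable_process_algebra) (use t in auto)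
    then have "?Z \<in> borel_measurable ?AB" by measurable
    from measurable_sets[OF this S] show "?Z -` S \<inter> space M \<in> process_events M borel {0..} B"
      by (simp add: sets_process_algebra)
  qed
  have factor: "\<theta> * c * t + (l * t * (E - 1) + S * t) = (c * \<theta> - l + l * E + S) * t" for E S
    by (simp add: algebra_simps)
  have "(\<integral>\<^sup>+\<omega>. ennreal (exp (\<theta> * R \<omega>)) \<partial>M) =
      (\<Sum>n. ennreal (exp (\<theta> * c * t)) * (\<integral>\<^sup>+\<omega>. ?X n \<omega> * ?Y n \<omega> * ?Z \<omega> \<partial>M))"
    unfolding pw nn_integral_suminf[OF borel_measurable_times_ennreal[OF borel_measurable_const XYZ]]
      nn_integral_cmult[OF XYZ] ..
  also have "\<dots> = ennreal (exp (\<theta> * c * t)) *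
      ((\<Sum>n. emeasure M {\<omega> \<in> space M. ?V \<omega> = n} * ennreal ?d ^ n) * ennreal (exp (\<sigma>\<^sup>2 * \<theta>\<^sup>2 / 2 * t)))"
    unfolding E3 EX EY EZ by simp
  also have "\<dots> = ennreal (exp (\<theta> * c * t)) * (ennreal (exp (l * t * (exp (l * (?d - 1)) - 1))) *
      ennreal (exp (\<sigma>\<^sup>2 * \<theta>\<^sup>2 / 2 * t)))"
    using \<delta> \<theta> by (subst pgf_twice_iterated[OF N1 N2 l t indN]) auto
  also have "\<dots> = ennreal (exp (\<theta> * c * t + (l * t * (exp (l * (?d - 1)) - 1) + \<sigma>\<^sup>2 * \<theta>\<^sup>2 / 2 * t)))"
    by (simp only: ennreal_mult[symmetric] exp_add exp_ge_zero mult_nonneg_nonneg)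
  also have "l * (?d - 1) = - l + l * \<delta> / (\<delta> + \<theta>)" by (simp add: right_diff_distrib)
  also have "\<theta> * c * t + (l * t * (exp (- l + l * \<delta> / (\<delta> + \<theta>)) - 1) + \<sigma>\<^sup>2 * \<theta>\<^sup>2 / 2 * t) =
      (c * \<theta> - l + l * exp (- l + l * \<delta> / (\<delta> + \<theta>)) + \<sigma>\<^sup>2 * \<theta>\<^sup>2 / 2) * t"
    by (rule factor)
  finally show "(\<integral>\<^sup>+\<omega>. ennreal (exp (\<theta> * R \<omega>)) \<partial>M) = ennreal (exp (risk_exponent l \<delta> c \<sigma> \<theta> * t))"
    unfolding risk_exponent_def .
qed

end

theorem proposition3p5:
  fixes M :: "'a measure"
    and l \<delta> \<sigma> c q :: real
    and N1 N2 :: "real \<Rightarrow> 'a \<Rightarrow> nat"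
    and \<xi> :: "nat \<Rightarrow> 'a \<Rightarrow> real"
    and B :: "real \<Rightarrow> 'a \<Rightarrow> real"
  assumes "prob_space M"
    and "l > 0" and "\<delta> > 0" and "\<sigma> > 0" and "c > 0" and "q \<ge> 0"
    and "poisson_process M l N1" and "poisson_process M l N2"
    and "prob_space.indep_set M
           (process_events M (count_space UNIV) {0..} N1)
           (process_events M (count_space UNIV) {0..} N2)"
    and "\<And>i. i \<ge> 1 \<Longrightarrow> distributed M lborel (\<xi> i) (exponential_density \<delta>)"
    and "prob_space.indep_vars M (\<lambda>_. borel) \<xi> {1..}"
    and "brownian_motion M B"
    and "prob_space.indep_sets M
           ((!) [process_events M (count_space UNIV) {0..} (twice_iterated N1 N2),
                 process_events M borel {1..} \<xi>,
                 process_events M borel {0..} B]) {..<3}"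
  shows "(\<forall>x. summable (\<lambda>n. scale_term l \<delta> c \<sigma> q n x)) \<and>
         scale_function M (risk_process c \<sigma> (twice_iterated N1 N2) \<xi> B) q =
           (\<lambda>x. 1 / c * conv unit_step (\<lambda>y. \<Sum>n. scale_term l \<delta> c \<sigma> q n y) x)"
proof
  let ?R = "risk_process c \<sigma> (twice_iterated N1 N2) \<xi> B"
  let ?W = "\<lambda>x. 1 / c * conv unit_step (\<lambda>y. \<Sum>n. scale_term l \<delta> c \<sigma> q n y) x"
  interpret prob_space M by fact
  show "\<forall>x. summable (\<lambda>n. scale_term l \<delta> c \<sigma> q n x)"
    using summable_scale_term[OF assms(3,2,5,6,4)] by blast
  \<comment> \<open>Nonnegative arguments suffice: \<open>right_inverse\<close> ranges over \<theta>
    \<ge> 0, and the transforms are compared only at points beyond it, which are positive.\<close>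
  have "laplace_exponent M ?R \<theta> = risk_exponent l \<delta> c \<sigma> \<theta>" if "\<theta> \<ge> 0" for \<theta>
  proof (rule laplace_exponent_eqI)
    fix t :: real assume t: "0 \<le> t"
    show "?R t \<in> borel_measurable M"
      by (rule borel_measurable_risk_process[OF assms(2,3) t that assms(7-13)])
    show "(\<integral>\<^sup>+\<omega>. ennreal (exp (\<theta> * ?R t \<omega>)) \<partial>M) = ennreal (exp (risk_exponent l \<delta> c \<sigma> \<theta> * t))"
      by (rule nn_integral_exp_risk_process[OF assms(2,3) t that assms(7-13)])
  qed
  then have W: "is_scale_function (laplace_exponent M ?R) q ?W"
    by (rule is_scale_function_risk_exponent[OF assms(3,2,5,6,4)])
  show "scale_function M ?R q = ?W"
    unfolding scale_function_def
    by (rule the_equality, rule W, rule is_scale_function_unique[OF _ W])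
qed

end
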